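(* Consider the Schrödinger bridge $\widehat{\mathbf P}$ for the reference measure $\mathbf R$ and targets $\rho_0,\rho_T$, under Assumptions (C) and (G), and suppose that Assumption (D) holds. Let $(\varphi,\widehat\varphi)$ be the Schrödinger potentials. Then $\widehat{\mathbf P}$ admits a transition density function $\widehat p$, in the sense that $\widehat{\mathbf P}(X_s\in B,\Lambda_s=j\mid(X_t,\Lambda_t)=(x,i))=\int_B\widehat p_{ij}(t,x,s,y)dy$ for Borel $B\subseteq\mathbb R^d$, and it is given, for $x,y\in\mathbb R^d$, $i,j\in\mathcal S$ and $0\le t<s\le T$, by $$\widehat p_{ij}(t,x,s,y)=\begin{cases}\dfrac{\varphi(s,y,j)}{\varphi(t,x,i)}\,p_{ij}(t,x,s,y)&\text{if }\varphi(t,x,i)>0,\\ 0&\text{otherwise.}\end{cases}$$ Further, for every $t\in(0,T]$, the marginal distribution $\widehat{\mathbf P}_t$ possesses the density function $$\widehat{\mathbf P}_t(x,i)=\varphi(t,x,i)\,\widehat\varphi(t,x,i)\quad\text{for }(x,i)\in\mathbb R^d\times\mathcal S.$$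
   Context: **Path space.** Fix $T>0$, $d,\ell\ge1$ and a finite set of regimes $\mathcal S=\{1,\dots,|\mathcal S|\}$. $\Omega=D([0,T];\mathbb R^d\times\mathcal S)$ is the Skorokhod space of càdlàg paths, with Borel $\sigma$-algebra $\mathcal F$, canonical process $(X_t,\Lambda_t)(\omega)=\omega(t)$ and its natural filtration (or usual augmentation) $\{\mathcal F_t\}$. A path measure is a probability measure on $\Omega$; $\mathbf P_t$ is the law of $(X_t,\Lambda_t)$ under $\mathbf P$. For a measure $\mu$ on $\mathbb R^d\times\mathcal S$, $\mu(\cdot,i)$ is the measure $B\mapsto\mu(B\times\{i\})$ on $\mathbb R^d$; densities on $\mathbb R^d\times\mathcal S$ are with respect to Lebesgue measure times counting measure. $\mathrm{KL}(\mathbf P\|\mathbf R)=\mathbf E_{\mathbf P}[\log\frac{d\mathbf P}{d\mathbf R}]$ if $\mathbf P\ll\mathbf R$, $+\infty$ otherwise. **Reference SDE.** Given $Q_{ij}(t,x)$, fix for each $(t,x)$ subsets $\Delta_{ij}(t,x)\subset\mathbb R_+$ with $\Delta_{ii}(t,x)=\emptyset$ and, for $i\ne j$, disjoint intervals $\Delta_{ij}(t,x)$ of length $Q_{ij}(t,x)$. Put $\alpha(t,x,i,w)=\sum_{j}(j-i)\mathbf 1_{\Delta_{ij}(t,x)}(w)$ and $\beta(t,x,i,w)=\sum_j(\psi_{ij}(t,x)-x)\mathbf 1_{\Delta_{ij}(t,x)}(w)$. The reference SDE is $$dX_t=b(t,X_t,\Lambda_t)dt+\sigma(t,X_t,\Lambda_t)dB_t+\int_{|z|\le1}\gamma(t,X_{t-},\Lambda_{t-},z)\tilde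 N(dt,dz)+\int_{|z|>1}\gamma(t,X_{t-},\Lambda_{t-},z)N(dt,dz)+\int_{\mathbb R_+}\beta(t,X_{t-},\Lambda_{t-},w)N_1(dt,dw),$$ $$d\Lambda_t=\int_{\mathbb R_+}\alpha(t,X_{t-},\Lambda_{t-},w)N_1(dt,dw),$$ with $B$ a standard $d$-dimensional Brownian motion, $N$ a Poisson random measure on $\mathbb R^\ell$ with intensity $\nu(dz)$, $\tilde N=N-\nu(dz)dt$, and $N_1$ a Poisson random measure on $\mathbb R_+$ with Lebesgue intensity. Only weak solutions are considered. **Assumption (C).** $b:[0,T]\times\mathbb R^d\times\mathcal S\to\mathbb R^d$ and $\sigma:[0,T]\times\mathbb R^d\times\mathcal S\to\mathbb R^{d\times d}$ are measurable and locally bounded, $\sigma\sigma^\top$ is non-negative definite; $\gamma:[0,T]\times\mathbb R^d\times\mathcal S\times\mathbb R^\ell\to\mathbb R^d$ is measurable, $\gamma(t,x,i,0)=0$ and $\sup_z\frac{|\gamma(t,x,i,z)|}{1\wedge|z|}$ is locally bounded in $(t,x,i)$; $\nu$ is a Lévy measure ($\nu(\{0\})=0$, $\int(1\wedge|z|^2)\nu(dz)<\infty$); each $\psi_{ij}:[0,T]\times\mathbb R^d\to\mathbb R^d$ is measurable and locally bounded with $\psi_{ii}(t,x)=x$; for $i\neq j$, $Q_{ij}:[0,T]\times\mathbb R^d\to\mathbb R_+$ is measurable and locally bounded. **Assumption (G).** (G1) For every $(t,x,i)$ the SDE has a solution $\mathbf P^{t,x,i}$ on $\Omega$, satisfying the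 SDE for $r\in[t,T]$ with $(X_t,\Lambda_t)\equiv(x,i)$, and the family is strong Markovian: for every stopping time $\tau\in[t,T]$, the conditional law of $\mathbf P^{t,x,i}$ given $\mathcal F_\tau$ is $\mathbf P^{\tau,X_\tau,\Lambda_\tau}$. (G2) $\mathbf R$ is the solution of the SDE with initial law $\mathbf R_0$; its endpoint law satisfies $\mathbf R_{0T}\ll\mathbf R_0\otimes\mathbf R_T$; and the probability measures $\rho_0,\rho_T$ on $\mathbb R^d\times\mathcal S$ satisfy $\mathrm{KL}(\rho_0\otimes\rho_T\|\mathbf R_{0T})<\infty$. **Schrödinger bridge.** $\widehat{\mathbf P}$ is the minimizer of $\mathrm{KL}(\mathbf P\|\mathbf R)$ over path measures with $\mathbf P_0=\rho_0,\mathbf P_T=\rho_T$. Under (G) it is known that $\widehat{\mathbf P}$ exists, is unique, and $\widehat{\mathbf P}=\mathfrak f(X_0,\Lambda_0)\mathfrak g(X_T,\Lambda_T)\mathbf R$ with measurable $\mathfrak f,\mathfrak g:\mathbb R^d\times\mathcal S\to\mathbb R_+$ solving $\mathfrak f(x,i)\mathbf E_{\mathbf R}[\mathfrak g(X_T,\Lambda_T)|(X_0,\Lambda_0)=(x,i)]=\frac{d\rho_0}{d\mathbf R_0}(x,i)$ for $\mathbf R_0$-a.e. $(x,i)$ and $\mathfrak g(y,j)\mathbf E_{\mathbf R}[\mathfrak f(X_0,\Lambda_0)|(X_T,\Lambda_T)=(y,j)]=\frac{d\rho_T}{d\mathbf R_T}(y,j)$ for $\mathbf R_T$-a.e. $(y,j)$.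 **Assumption (D).** (D1) For every $(x,i)$ and $0\le t<s\le T$ there is a function $(y,j)\mapsto p_{ij}(t,x,s,y)$ with $\mathbf R(X_s\in B,\Lambda_s=j|(X_t,\Lambda_t)=(x,i))=\int_Bp_{ij}(t,x,s,y)dy$ for Borel $B\subseteq\mathbb R^d$; and for all $i,j$, $t<s$, $(x,y)\mapsto p_{ij}(t,x,s,y)$ is bounded on $\mathbb R^d\times\mathbb R^d$. (D2) For all $i,j\in\mathcal S$, $\int_{\mathbb R^d}\mathfrak f(x,i)\mathbf R_0(dx,i)<\infty$ and $\sup_{y\in\mathrm{supp}(\mathbf R_T(\cdot,j))}\mathfrak g(y,j)<\infty$; since values of $\mathfrak g(\cdot,j)$ outside $\mathrm{supp}(\mathbf R_T(\cdot,j))$ are irrelevant, $\mathfrak g(\cdot,j)$ is taken bounded on $\mathbb R^d$. **Schrödinger potentials.** $\varphi(t,x,i)=\sum_{j}\int_{\mathbb R^d}\mathfrak g(y,j)p_{ij}(t,x,T,y)dy$ for $t\in[0,T)$, $\varphi(T,x,i)=\mathfrak g(x,i)$; $\widehat\varphi(s,y,j)=\sum_i\int_{\mathbb R^d}\mathfrak f(x,i)p_{ij}(0,x,s,y)\mathbf R_0(dx,i)$ for $s\in(0,T]$, and $\widehat\varphi(0,dy,j)=\mathfrak f(y,j)\mathbf R_0(dy,j)$ as a measure. *)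

theory Defs
  imports "HOL-Probability.Probability"
begin

section \<open>Data of the reference SDE\<close>

text \<open>Regimes are the naturals \<open>1..regimes S\<close>; \<open>R\<^sup>d\<close> and \<open>R\<^sup>l\<close> are \<open>real ^ 'd\<close> and \<open>real ^ 'l\<close>.
  The fields stand, in order, for \<open>T\<close>, the number of regimes, \<open>b\<close>, \<open>\<sigma>\<close>, \<open>\<gamma>\<close>, \<open>\<nu>\<close>, \<open>\<psi>\<close>, \<open>Q\<close> and \<open>\<Delta>\<close>;
  functions of time are only used on \<open>[0,T]\<close>.\<close>

record ('d, 'l) sde =
  horizon :: real
  regimes :: nat
  drift :: "real \<Rightarrow> real ^ ('d::finite) \<Rightarrow> nat \<Rightarrow> real ^ 'd"
  diffusion :: "real \<Rightarrow> real ^ 'd \<Rightarrow> nat \<Rightarrow> real ^ 'd ^ 'd"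
  jump :: "real \<Rightarrow> real ^ 'd \<Rightarrow> nat \<Rightarrow> real ^ ('l::finite) \<Rightarrow> real ^ 'd"
  levy :: "(real ^ 'l) measure"
  relocation :: "nat \<Rightarrow> nat \<Rightarrow> real \<Rightarrow> real ^ 'd \<Rightarrow> real ^ 'd"
  rate :: "nat \<Rightarrow> nat \<Rightarrow> real \<Rightarrow> real ^ 'd \<Rightarrow> real"
  switch_set :: "nat \<Rightarrow> nat \<Rightarrow> real \<Rightarrow> real ^ 'd \<Rightarrow> real set"

definition regime_set :: "('d::finite, 'l::finite) sde \<Rightarrow> nat set" where
  "regime_set S = {1..regimes S}"

text \<open>This measure serves both as the measurable space \<open>R\<^sup>d \<times> S\<close> and as the reference measure for
  densities.\<close>

definition state :: "('d::finite, 'l::finite) sde \<Rightarrow> ((real ^ 'd) \<times> nat) measure" where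
  "state S = lborel \<Otimes>\<^sub>M count_space (regime_set S)"

definition time_state :: "('d::finite, 'l::finite) sde \<Rightarrow> (real \<times> (real ^ 'd) \<times> nat) measure" where
  "time_state S = restrict_space borel {0..horizon S} \<Otimes>\<^sub>M state S"

text \<open>The last clause (joint measurability of the sets \<open>\<Delta>\<^sub>i\<^sub>j\<close>) is what makes the integrands of the
  switching integrals measurable.\<close>

definition reference_data :: "('d::finite, 'l::finite) sde \<Rightarrow> bool" where
  "reference_data S \<longleftrightarrow>
    0 < horizon S \<and> 1 \<le> regimes S \<and>
    (\<forall>t\<in>{0..horizon S}. \<forall>x.
      (\<forall>i\<in>regime_set S. switch_set S i i t x = {}) \<and>
      (\<forall>i\<in>regime_set S. \<forall>j\<in>regime_set S. i \<noteq> j \<longrightarrow>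
        is_interval (switch_set S i j t x) \<and> switch_set S i j t x \<subseteq> {0..} \<and>
        emeasure lborel (switch_set S i j t x) = ennreal (rate S i j t x)) \<and>
      disjoint_family_on (\<lambda>(i, j). switch_set S i j t x)
        {(i, j). i \<in> regime_set S \<and> j \<in> regime_set S \<and> i \<noteq> j}) \<and>
    (\<forall>i\<in>regime_set S. \<forall>j\<in>regime_set S.
      {(t, x, v). t \<in> {0..horizon S} \<and> v \<in> switch_set S i j t x} \<in> sets (borel \<Otimes>\<^sub>M borel \<Otimes>\<^sub>M borel))"

definition locally_bounded :: "real \<Rightarrow> (real \<Rightarrow> real ^ 'd::finite \<Rightarrow> 'b::real_normed_vector) \<Rightarrow> bool" where
  "locally_bounded T h \<longleftrightarrow>
    (\<forall>C. compact C \<longrightarrow> bounded ((\<lambda>(t, x). h t x) ` ({0..T} \<times> C)))"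

definition levy_measure :: "(real ^ 'l::finite) measure \<Rightarrow> bool" where
  "levy_measure \<nu> \<longleftrightarrow> sets \<nu> = sets borel \<and> emeasure \<nu> {0} = 0 \<and>
    (\<integral>\<^sup>+z. ennreal (min 1 ((norm z)\<^sup>2)) \<partial>\<nu>) < \<infinity>"

definition assumption_C :: "('d::finite, 'l::finite) sde \<Rightarrow> bool" where
  "assumption_C S \<longleftrightarrow>
    (\<lambda>(t, x, i). drift S t x i) \<in> borel_measurable (time_state S) \<and>
    (\<forall>i\<in>regime_set S. locally_bounded (horizon S) (\<lambda>t x. drift S t x i)) \<and>
    (\<lambda>(t, x, i). diffusion S t x i) \<in> borel_measurable (time_state S) \<and>
    (\<forall>i\<in>regime_set S. locally_bounded (horizon S) (\<lambda>t x. diffusion S t x i)) \<and>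
    (\<forall>t\<in>{0..horizon S}. \<forall>x. \<forall>i\<in>regime_set S. \<forall>v.
      0 \<le> v \<bullet> ((diffusion S t x i ** transpose (diffusion S t x i)) *v v)) \<and>
    (\<lambda>((t, x, i), z). jump S t x i z) \<in> borel_measurable (time_state S \<Otimes>\<^sub>M borel) \<and>
    (\<forall>t\<in>{0..horizon S}. \<forall>x. \<forall>i\<in>regime_set S. jump S t x i 0 = 0) \<and>
    (\<forall>i\<in>regime_set S. \<forall>C. compact C \<longrightarrow>
      (\<exists>c. \<forall>t\<in>{0..horizon S}. \<forall>x\<in>C. \<forall>z. norm (jump S t x i z) / min 1 (norm z) \<le> c)) \<and>
    levy_measure (levy S) \<and>
    (\<forall>i\<in>regime_set S. \<forall>j\<in>regime_set S.
      (\<lambda>(t, x). relocation S i j t x)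
        \<in> borel_measurable (restrict_space borel {0..horizon S} \<Otimes>\<^sub>M borel) \<and>
      locally_bounded (horizon S) (relocation S i j)) \<and>
    (\<forall>t\<in>{0..horizon S}. \<forall>x. \<forall>i\<in>regime_set S. relocation S i i t x = x) \<and>
    (\<forall>i\<in>regime_set S. \<forall>j\<in>regime_set S. i \<noteq> j \<longrightarrow>
      (\<lambda>(t, x). rate S i j t x)
        \<in> borel_measurable (restrict_space borel {0..horizon S} \<Otimes>\<^sub>M borel) \<and>
      locally_bounded (horizon S) (rate S i j) \<and>
      (\<forall>t\<in>{0..horizon S}. \<forall>x. 0 \<le> rate S i j t x))"


section \<open>Skorokhod space\<close>

definition paths :: "('d::finite, 'l::finite) sde \<Rightarrow> (real \<Rightarrow> (real ^ 'd) \<times> nat) set" where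
  "paths S = {\<omega> \<in> {0..horizon S} \<rightarrow>\<^sub>E UNIV \<times> regime_set S.
    (\<forall>t\<in>{0..<horizon S}. (\<omega> \<longlongrightarrow> \<omega> t) (at_right t)) \<and>
    (\<forall>t\<in>{0<..horizon S}. \<exists>l. (\<omega> \<longlongrightarrow> l) (at_left t))}"

text \<open>Balls of Skorokhod's \<open>J\<^sub>1\<close> metric; a strictly increasing map of \<open>[0,T]\<close> onto itself is
  automatically continuous.\<close>

definition skorokhod_close ::
    "real \<Rightarrow> real \<Rightarrow> (real \<Rightarrow> 'a::metric_space) \<Rightarrow> (real \<Rightarrow> 'a) \<Rightarrow> bool" where
  "skorokhod_close T e \<omega> \<eta> \<longleftrightarrow>
    (\<exists>l. strict_mono_on {0..T} l \<and> l ` {0..T} = {0..T} \<and>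
      (\<forall>t\<in>{0..T}. \<bar>l t - t\<bar> < e \<and> dist (\<omega> (l t)) (\<eta> t) < e))"

definition skorokhod_open ::
    "('d::finite, 'l::finite) sde \<Rightarrow> (real \<Rightarrow> (real ^ 'd) \<times> nat) set \<Rightarrow> bool" where
  "skorokhod_open S U \<longleftrightarrow> U \<subseteq> paths S \<and>
    (\<forall>\<omega>\<in>U. \<exists>e>0. \<forall>\<eta>\<in>paths S. skorokhod_close (horizon S) e \<omega> \<eta> \<longrightarrow> \<eta> \<in> U)"

definition path_space :: "('d::finite, 'l::finite) sde \<Rightarrow> (real \<Rightarrow> (real ^ 'd) \<times> nat) measure" where
  "path_space S = sigma (paths S) {U. skorokhod_open S U}"

definition path_measure ::
    "('d::finite, 'l::finite) sde \<Rightarrow> (real \<Rightarrow> (real ^ 'd) \<times> nat) measure \<Rightarrow> bool" where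
  "path_measure S P \<longleftrightarrow> P \<in> space (prob_algebra (path_space S))"

definition marginal ::
    "('d::finite, 'l::finite) sde \<Rightarrow> (real \<Rightarrow> (real ^ 'd) \<times> nat) measure \<Rightarrow> real \<Rightarrow> ((real ^ 'd) \<times> nat) measure"
  where "marginal S P t = distr P (state S) (\<lambda>\<omega>. \<omega> t)"

text \<open>The natural filtration, extended to all real indices: it is trivial before \<open>0\<close> and constant
  after \<open>T\<close>.\<close>

definition natural_filtration ::
    "('d::finite, 'l::finite) sde \<Rightarrow> real \<Rightarrow> (real \<Rightarrow> (real ^ 'd) \<times> nat) measure" where
  "natural_filtration S t = sigma (paths S)
    {(\<lambda>\<omega>. \<omega> u) -` A \<inter> paths S | u A. u \<in> {0..horizon S} \<and> u \<le> t \<and> A \<in> sets (state S)}"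

definition sigma_at ::
    "('d::finite, 'l::finite) sde \<Rightarrow> real \<Rightarrow> (real \<Rightarrow> (real ^ 'd) \<times> nat) measure" where
  "sigma_at S t = vimage_algebra (paths S) (\<lambda>\<omega>. \<omega> t) (state S)"

text \<open>The measure \<open>\<mu>(\<cdot>, i)\<close>, i.e. \<open>B \<mapsto> \<mu>(B \<times> {i})\<close>.\<close>

definition slice :: "((real ^ 'd::finite) \<times> nat) measure \<Rightarrow> nat \<Rightarrow> (real ^ 'd) measure" where
  "slice \<mu> i = distr (restrict_space \<mu> (UNIV \<times> {i})) borel fst"

text \<open>For probability measures the negative part of \<open>log (dP/dR)\<close> is \<open>P\<close>-integrable, so
  non-integrability means that the expectation is \<open>\<infinity>\<close>.\<close>

definition KL :: "'a measure \<Rightarrow> 'a measure \<Rightarrow> ereal" where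
  "KL P R =
    (if absolutely_continuous R P \<and> integrable P (entropy_density (exp 1) R P)
     then ereal (KL_divergence (exp 1) R P) else \<infinity>)"


section \<open>Driving noise\<close>

text \<open>All processes live on a filtered probability space \<open>(W, G)\<close>; \<open>'w\<close> is its type of outcomes.\<close>

definition brownian_motion ::
    "real \<Rightarrow> 'w measure \<Rightarrow> (real \<Rightarrow> 'w measure) \<Rightarrow> (real \<Rightarrow> 'w \<Rightarrow> real ^ 'd::finite) \<Rightarrow> bool" where
  "brownian_motion T W G B \<longleftrightarrow>
    (\<forall>u\<in>{0..T}. B u \<in> borel_measurable (G u)) \<and>
    (\<forall>w\<in>space W. continuous_on {0..T} (\<lambda>u. B u w)) \<and>
    (AE w in W. B 0 w = 0) \<and>
    (\<forall>u v. 0 \<le> u \<and> u < v \<and> v \<le> T \<longrightarrow>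
      prob_space.indep_vars W (\<lambda>_. borel) (\<lambda>k w. (B v w - B u w) $ k) UNIV \<and>
      (\<forall>k. distributed W lborel (\<lambda>w. (B v w - B u w) $ k)
        (\<lambda>x. ennreal (normal_density 0 (sqrt (v - u)) x))))"

text \<open>A Poisson random measure on \<open>(0,T] \<times> 'z\<close> with intensity \<open>dt \<nu>(dz)\<close>. Sets of infinite intensity
  need no separate clause, because \<open>\<nu>\<close> is \<open>\<sigma>\<close>-finite.\<close>

definition poisson_random_measure ::
    "real \<Rightarrow> 'w measure \<Rightarrow> (real \<Rightarrow> 'w measure) \<Rightarrow> 'z measure \<Rightarrow> ('w \<Rightarrow> (real \<times> 'z) measure) \<Rightarrow> bool" where
  "poisson_random_measure T W G \<nu> N \<longleftrightarrow>
    (\<forall>w\<in>space W. sets (N w) = sets (lborel \<Otimes>\<^sub>M \<nu>)) \<and>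
    (\<forall>u\<in>{0..T}. \<forall>A\<in>sets (lborel \<Otimes>\<^sub>M \<nu>). A \<subseteq> {0<..u} \<times> UNIV \<longrightarrow>
      (\<lambda>w. emeasure (N w) A) \<in> borel_measurable (G u)) \<and>
    (\<forall>A\<in>sets (lborel \<Otimes>\<^sub>M \<nu>). A \<subseteq> {0<..T} \<times> UNIV \<and> emeasure (lborel \<Otimes>\<^sub>M \<nu>) A < \<infinity> \<longrightarrow>
      (\<forall>n::nat. measure W {w \<in> space W. emeasure (N w) A = of_nat n} =
        measure (lborel \<Otimes>\<^sub>M \<nu>) A ^ n / fact n * exp (- measure (lborel \<Otimes>\<^sub>M \<nu>) A))) \<and>
    (\<forall>A :: nat \<Rightarrow> (real \<times> 'z) set.
      (\<forall>k. A k \<in> sets (lborel \<Otimes>\<^sub>M \<nu>) \<and> A k \<subseteq> {0<..T} \<times> UNIV) \<and> disjoint_family A \<longrightarrow>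
      prob_space.indep_vars W (\<lambda>_. borel) (\<lambda>k w. emeasure (N w) (A k)) UNIV)"

definition brownian_future ::
    "real \<Rightarrow> 'w measure \<Rightarrow> (real \<Rightarrow> 'w \<Rightarrow> real ^ 'd::finite) \<Rightarrow> real \<Rightarrow> 'w measure" where
  "brownian_future T W B u = sigma (space W)
    {(\<lambda>w. B v w - B u w) -` A \<inter> space W | v A. u \<le> v \<and> v \<le> T \<and> A \<in> sets borel}"

definition poisson_future ::
    "real \<Rightarrow> 'w measure \<Rightarrow> 'z measure \<Rightarrow> ('w \<Rightarrow> (real \<times> 'z) measure) \<Rightarrow> real \<Rightarrow> 'w measure" where
  "poisson_future T W \<nu> N u = sigma (space W)
    {(\<lambda>w. emeasure (N w) A) -` C \<inter> space W | A C.
      A \<in> sets (lborel \<Otimes>\<^sub>M \<nu>) \<and> A \<subseteq> {u<..T} \<times> UNIV \<and> C \<in> sets borel}"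

definition half_line :: "real measure" where
  "half_line = density lborel (indicator {0..})"

text \<open>\<open>B\<close>, \<open>N\<close>, \<open>N\<^sub>1\<close> are mutually independent, with increments independent of the past.\<close>

definition driving_noise ::
    "('d::finite, 'l::finite) sde \<Rightarrow> 'w measure \<Rightarrow> (real \<Rightarrow> 'w measure) \<Rightarrow> (real \<Rightarrow> 'w \<Rightarrow> real ^ 'd) \<Rightarrow>
      ('w \<Rightarrow> (real \<times> (real ^ 'l)) measure) \<Rightarrow> ('w \<Rightarrow> (real \<times> real) measure) \<Rightarrow> bool" where
  "driving_noise S W G B N N1 \<longleftrightarrow>
    prob_space W \<and> filtration (space W) G \<and> (\<forall>u. subalgebra W (G u)) \<and>
    brownian_motion (horizon S) W G B \<and>
    poisson_random_measure (horizon S) W G (levy S) N \<and>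
    poisson_random_measure (horizon S) W G half_line N1 \<and>
    (\<forall>u\<in>{0..horizon S}. prob_space.indep_sets W
      (\<lambda>k. [sets (G u),
            sets (brownian_future (horizon S) W B u),
            sets (poisson_future (horizon S) W (levy S) N u),
            sets (poisson_future (horizon S) W half_line N1 u)] ! k) {..<4})"


section \<open>Stochastic integrals and weak solutions\<close>

text \<open>A simple predictable integrand \<open>\<Sum>k<n. \<xi>\<^sub>k 1\<^bsub>(\<pi>\<^sub>k, \<pi>\<^sub>k\<^sub>+\<^sub>1]\<^esub>\<close> with bounded \<open>\<xi>\<^sub>k\<close>, and its integral
  against \<open>B\<close>.\<close>

definition simple_integrand ::
    "(real \<Rightarrow> 'w measure) \<Rightarrow> real \<Rightarrow> real \<Rightarrow> nat \<Rightarrow> (nat \<Rightarrow> real) \<Rightarrow> (nat \<Rightarrow> 'w \<Rightarrow> real ^ 'd ^ 'd::finite) \<Rightarrow> bool"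
  where
  "simple_integrand G a T n \<pi> \<xi> \<longleftrightarrow>
    (\<forall>k\<le>n. \<pi> k \<in> {a..T}) \<and> (\<forall>k<n. \<pi> k \<le> \<pi> (Suc k)) \<and>
    (\<forall>k<n. \<xi> k \<in> borel_measurable (G (\<pi> k)) \<and> (\<exists>c. \<forall>w\<in>space (G (\<pi> k)). norm (\<xi> k w) \<le> c))"

definition simple_process ::
    "nat \<Rightarrow> (nat \<Rightarrow> real) \<Rightarrow> (nat \<Rightarrow> 'w \<Rightarrow> real ^ 'd ^ 'd::finite) \<Rightarrow> real \<Rightarrow> 'w \<Rightarrow> real ^ 'd ^ 'd" where
  "simple_process n \<pi> \<xi> u w = (\<Sum>k<n. indicator {\<pi> k<..\<pi> (Suc k)} u *\<^sub>R \<xi> k w)"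

definition simple_ito ::
    "(real \<Rightarrow> 'w \<Rightarrow> real ^ 'd::finite) \<Rightarrow> nat \<Rightarrow> (nat \<Rightarrow> real) \<Rightarrow> (nat \<Rightarrow> 'w \<Rightarrow> real ^ 'd ^ 'd) \<Rightarrow>
      real \<Rightarrow> 'w \<Rightarrow> real ^ 'd" where
  "simple_ito B n \<pi> \<xi> r w =
    (\<Sum>k<n. \<xi> k w *v (B (min r (\<pi> (Suc k))) w - B (min r (\<pi> k)) w))"

text \<open>\<open>Y\<close> is (a version of) the Ito integral \<open>\<integral>\<^sub>a H dB\<close> on \<open>[a,T]\<close>. The usual construction takes the limit of
  \<open>\<integral>\<^sub>a H\<^sub>m dB\<close>, uniformly on \<open>[a,T]\<close> in probability, for simple \<open>H\<^sub>m\<close> with \<open>\<integral> |H\<^sub>m - H|\<^sup>2 du \<longrightarrow> 0\<close> in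
  probability; after passing to a subsequence both limits are almost sure.\<close>

definition is_ito_integral ::
    "'w measure \<Rightarrow> (real \<Rightarrow> 'w measure) \<Rightarrow> (real \<Rightarrow> 'w \<Rightarrow> real ^ 'd::finite) \<Rightarrow> real \<Rightarrow> real \<Rightarrow>
      (real \<Rightarrow> 'w \<Rightarrow> real ^ 'd ^ 'd) \<Rightarrow> (real \<Rightarrow> 'w \<Rightarrow> real ^ 'd) \<Rightarrow> bool" where
  "is_ito_integral W G B a T H Y \<longleftrightarrow>
    (\<exists>n \<pi> \<xi>. (\<forall>m::nat. simple_integrand G a T (n m) (\<pi> m) (\<xi> m)) \<and>
      (AE w in W.
        (\<lambda>m. \<integral>\<^sup>+u\<in>{a..T}. ennreal ((norm (simple_process (n m) (\<pi> m) (\<xi> m) u w - H u w))\<^sup>2) \<partial>lborel)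
          \<longlonglongrightarrow> 0) \<and>
      (AE w in W.
        uniform_limit {a..T} (\<lambda>m r. simple_ito B (n m) (\<pi> m) (\<xi> m) r w) (\<lambda>r. Y r w) sequentially))"

text \<open>\<open>Y\<close> is (a version of) the compensated integral
  \<open>\<integral>\<^bsub>(a,r]\<^esub> \<integral>\<^bsub>|z| \<le> 1\<^esub> H(u,z) (N(du,dz) - \<nu>(dz) du)\<close>: the limit as \<open>\<epsilon> \<longrightarrow> 0\<close>, uniformly on \<open>[a,T]\<close> in
  probability, of the integrals over \<open>\<epsilon> < |z| \<le> 1\<close>, where \<open>\<nu>\<close> is finite. Along a suitable
  sequence of cut-offs the limit is almost sure.\<close>

definition is_compensated_integral ::
    "'w measure \<Rightarrow> (real ^ 'l::finite) measure \<Rightarrow> ('w \<Rightarrow> (real \<times> (real ^ 'l)) measure) \<Rightarrow> real \<Rightarrow> real \<Rightarrow>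
      (real \<Rightarrow> real ^ 'l \<Rightarrow> 'w \<Rightarrow> real ^ 'd::finite) \<Rightarrow> (real \<Rightarrow> 'w \<Rightarrow> real ^ 'd) \<Rightarrow> bool" where
  "is_compensated_integral W \<nu> N a T H Y \<longleftrightarrow>
    (\<exists>\<epsilon>. (\<forall>m::nat. 0 < \<epsilon> m) \<and> \<epsilon> \<longlonglongrightarrow> 0 \<and>
      (AE w in W. uniform_limit {a..T}
        (\<lambda>m r.
          set_lebesgue_integral (N w) ({a<..r} \<times> {z. \<epsilon> m < norm z \<and> norm z \<le> 1}) (\<lambda>(u, z). H u z w) -
          set_lebesgue_integral (lborel \<Otimes>\<^sub>M \<nu>) ({a<..r} \<times> {z. \<epsilon> m < norm z \<and> norm z \<le> 1})
            (\<lambda>(u, z). H u z w))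
        (\<lambda>r. Y r w) sequentially))"

definition alpha :: "('d::finite, 'l::finite) sde \<Rightarrow> real \<Rightarrow> real ^ 'd \<Rightarrow> nat \<Rightarrow> real \<Rightarrow> real" where
  "alpha S t x i v = (\<Sum>j\<in>regime_set S. (real j - real i) * indicator (switch_set S i j t x) v)"

definition beta :: "('d::finite, 'l::finite) sde \<Rightarrow> real \<Rightarrow> real ^ 'd \<Rightarrow> nat \<Rightarrow> real \<Rightarrow> real ^ 'd" where
  "beta S t x i v =
    (\<Sum>j\<in>regime_set S. indicator (switch_set S i j t x) v *\<^sub>R (relocation S i j t x - x))"

definition left_limit :: "(real \<Rightarrow> 'w \<Rightarrow> 'a::t2_space) \<Rightarrow> real \<Rightarrow> 'w \<Rightarrow> 'a" where
  "left_limit Z u w = Lim (at_left u) (\<lambda>r. Z r w)"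

definition satisfies_sde ::
    "('d::finite, 'l::finite) sde \<Rightarrow> real \<Rightarrow> 'w measure \<Rightarrow> (real \<Rightarrow> 'w measure) \<Rightarrow> (real \<Rightarrow> 'w \<Rightarrow> real ^ 'd) \<Rightarrow>
      ('w \<Rightarrow> (real \<times> (real ^ 'l)) measure) \<Rightarrow> ('w \<Rightarrow> (real \<times> real) measure) \<Rightarrow>
      (real \<Rightarrow> 'w \<Rightarrow> (real ^ 'd) \<times> nat) \<Rightarrow> bool" where
  "satisfies_sde S a W G B N N1 Z \<longleftrightarrow>
    (let T = horizon S;
         X = (\<lambda>u w. fst (Z u w)); L = (\<lambda>u w. snd (Z u w));
         X' = (\<lambda>u w. fst (left_limit Z u w)); L' = (\<lambda>u w. snd (left_limit Z u w))
     in \<exists>M J.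
      is_ito_integral W G B a T (\<lambda>u w. diffusion S u (X u w) (L u w)) M \<and>
      is_compensated_integral W (levy S) N a T (\<lambda>u z w. jump S u (X' u w) (L' u w) z) J \<and>
      (AE w in W. \<forall>r\<in>{a..T}.
        X r w = X a w
          + set_lebesgue_integral lborel {a..r} (\<lambda>u. drift S u (X u w) (L u w))
          + M r w + J r w
          + set_lebesgue_integral (N w) ({a<..r} \<times> {z. 1 < norm z})
              (\<lambda>(u, z). jump S u (X' u w) (L' u w) z)
          + set_lebesgue_integral (N1 w) ({a<..r} \<times> {0..})
              (\<lambda>(u, v). beta S u (X' u w) (L' u w) v) \<and>
        real (L r w) = real (L a w)
          + set_lebesgue_integral (N1 w) ({a<..r} \<times> {0..})
              (\<lambda>(u, v). alpha S u (X' u w) (L' u w) v)))"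

text \<open>\<open>P\<close> is the law of a solution on \<open>[a,T]\<close> carried by some filtered probability space with outcomes
  in \<open>'w\<close>; HOL cannot quantify existentially over this type, so it is a parameter.\<close>

definition weak_solution ::
    "'w itself \<Rightarrow> ('d::finite, 'l::finite) sde \<Rightarrow> real \<Rightarrow> (real \<Rightarrow> (real ^ 'd) \<times> nat) measure \<Rightarrow> bool" where
  "weak_solution w S a P \<longleftrightarrow>
    path_measure S P \<and>
    (\<exists>(W :: 'w measure) G B N N1 Z.
      driving_noise S W G B N N1 \<and>
      (\<forall>u\<in>{0..horizon S}. Z u \<in> measurable (G u) (state S)) \<and>
      (\<lambda>w. \<lambda>u\<in>{0..horizon S}. Z u w) \<in> measurable W (path_space S) \<and>
      satisfies_sde S a W G B N N1 Z \<and>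
      P = distr W (path_space S) (\<lambda>w. \<lambda>u\<in>{0..horizon S}. Z u w))"


section \<open>Assumption (G)\<close>

text \<open>\<open>freeze T u\<close> forgets the path before time \<open>u\<close>: since \<open>P\<^sup>t\<^sup>,\<^sup>x\<^sup>,\<^sup>i\<close> is only specified on \<open>[t,T]\<close>, the
  strong Markov property compares laws of the path after \<open>\<tau>\<close>.\<close>

definition freeze :: "real \<Rightarrow> real \<Rightarrow> (real \<Rightarrow> 'a) \<Rightarrow> real \<Rightarrow> 'a" where
  "freeze T u \<omega> = (\<lambda>r\<in>{0..T}. \<omega> (max u r))"

definition strong_markov_family ::
    "('d::finite, 'l::finite) sde \<Rightarrow>
      (real \<Rightarrow> real ^ 'd \<Rightarrow> nat \<Rightarrow> (real \<Rightarrow> (real ^ 'd) \<times> nat) measure) \<Rightarrow> bool" where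
  "strong_markov_family S PP \<longleftrightarrow>
    (\<forall>t\<in>{0..horizon S}. \<forall>x. \<forall>i\<in>regime_set S. \<forall>\<tau>.
      stopping_time (natural_filtration S) \<tau> \<and> (\<forall>\<omega>\<in>paths S. \<tau> \<omega> \<in> {t..horizon S}) \<longrightarrow>
      (\<forall>A\<in>sets (path_space S). AE \<omega> in PP t x i.
        nn_cond_exp (PP t x i) (filtration.pre_sigma (paths S) (natural_filtration S) \<tau>)
          (indicator {\<eta> \<in> paths S. freeze (horizon S) (\<tau> \<eta>) \<eta> \<in> A}) \<omega> =
        emeasure (PP (\<tau> \<omega>) (fst (\<omega> (\<tau> \<omega>))) (snd (\<omega> (\<tau> \<omega>))))
          {\<eta> \<in> paths S. freeze (horizon S) (\<tau> \<omega>) \<eta> \<in> A}))"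

definition assumption_G1 ::
    "'w itself \<Rightarrow> ('d::finite, 'l::finite) sde \<Rightarrow>
      (real \<Rightarrow> real ^ 'd \<Rightarrow> nat \<Rightarrow> (real \<Rightarrow> (real ^ 'd) \<times> nat) measure) \<Rightarrow> bool" where
  "assumption_G1 w S PP \<longleftrightarrow>
    (\<forall>t\<in>{0..horizon S}. \<forall>x. \<forall>i\<in>regime_set S.
      weak_solution w S t (PP t x i) \<and> (AE \<omega> in PP t x i. \<omega> t = (x, i))) \<and>
    strong_markov_family S PP"

text \<open>\<open>R\<close> is the solution with initial law \<open>R\<^sub>0\<close>: the member of the Markov family with that initial
  law, i.e. its conditional law given \<open>(X\<^sub>0, \<Lambda>\<^sub>0) = (x, i)\<close> is \<open>P\<^sup>0\<^sup>,\<^sup>x\<^sup>,\<^sup>i\<close>.\<close>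

definition assumption_G2 ::
    "'w itself \<Rightarrow> ('d::finite, 'l::finite) sde \<Rightarrow>
      (real \<Rightarrow> real ^ 'd \<Rightarrow> nat \<Rightarrow> (real \<Rightarrow> (real ^ 'd) \<times> nat) measure) \<Rightarrow>
      ((real ^ 'd) \<times> nat) measure \<Rightarrow> (real \<Rightarrow> (real ^ 'd) \<times> nat) measure \<Rightarrow>
      ((real ^ 'd) \<times> nat) measure \<Rightarrow> ((real ^ 'd) \<times> nat) measure \<Rightarrow> bool" where
  "assumption_G2 w S PP R0 R \<rho>0 \<rho>T \<longleftrightarrow>
    weak_solution w S 0 R \<and> marginal S R 0 = R0 \<and>
    (\<forall>A\<in>sets (path_space S). AE \<omega> in R.
      nn_cond_exp R (sigma_at S 0) (indicator A) \<omega> = emeasure (PP 0 (fst (\<omega> 0)) (snd (\<omega> 0))) A) \<and>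
    \<rho>0 \<in> space (prob_algebra (state S)) \<and> \<rho>T \<in> space (prob_algebra (state S)) \<and>
    (let R0T = distr R (state S \<Otimes>\<^sub>M state S) (\<lambda>\<omega>. (\<omega> 0, \<omega> (horizon S)))
     in absolutely_continuous (R0 \<Otimes>\<^sub>M marginal S R (horizon S)) R0T \<and>
        KL (\<rho>0 \<Otimes>\<^sub>M \<rho>T) R0T < \<infinity>)"


section \<open>Schroedinger bridge and potentials\<close>

definition schroedinger_bridge ::
    "('d::finite, 'l::finite) sde \<Rightarrow> (real \<Rightarrow> (real ^ 'd) \<times> nat) measure \<Rightarrow>
      ((real ^ 'd) \<times> nat) measure \<Rightarrow> ((real ^ 'd) \<times> nat) measure \<Rightarrow>
      (real \<Rightarrow> (real ^ 'd) \<times> nat) measure \<Rightarrow> bool" where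
  "schroedinger_bridge S R \<rho>0 \<rho>T Phat \<longleftrightarrow>
    is_arg_min (\<lambda>P. KL P R)
      (\<lambda>P. path_measure S P \<and> marginal S P 0 = \<rho>0 \<and> marginal S P (horizon S) = \<rho>T) Phat"

definition schroedinger_factors ::
    "('d::finite, 'l::finite) sde \<Rightarrow> (real \<Rightarrow> (real ^ 'd) \<times> nat) measure \<Rightarrow>
      ((real ^ 'd) \<times> nat) measure \<Rightarrow> ((real ^ 'd) \<times> nat) measure \<Rightarrow>
      (real \<Rightarrow> (real ^ 'd) \<times> nat) measure \<Rightarrow>
      ((real ^ 'd) \<times> nat \<Rightarrow> real) \<Rightarrow> ((real ^ 'd) \<times> nat \<Rightarrow> real) \<Rightarrow> bool" where
  "schroedinger_factors S R \<rho>0 \<rho>T Phat f g \<longleftrightarrow>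
    f \<in> borel_measurable (state S) \<and> g \<in> borel_measurable (state S) \<and>
    (\<forall>z\<in>space (state S). 0 \<le> f z \<and> 0 \<le> g z) \<and>
    Phat = density R (\<lambda>\<omega>. ennreal (f (\<omega> 0) * g (\<omega> (horizon S)))) \<and>
    (AE \<omega> in R.
      ennreal (f (\<omega> 0)) * nn_cond_exp R (sigma_at S 0) (\<lambda>\<eta>. ennreal (g (\<eta> (horizon S)))) \<omega> =
      RN_deriv (marginal S R 0) \<rho>0 (\<omega> 0)) \<and>
    (AE \<omega> in R.
      ennreal (g (\<omega> (horizon S))) * nn_cond_exp R (sigma_at S (horizon S)) (\<lambda>\<eta>. ennreal (f (\<eta> 0))) \<omega> =
      RN_deriv (marginal S R (horizon S)) \<rho>T (\<omega> (horizon S)))"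

text \<open>Transition densities are written \<open>p i j t x s y\<close> for \<open>p\<^sub>i\<^sub>j(t,x,s,y)\<close>.\<close>

type_synonym 'd kernel = "nat \<Rightarrow> nat \<Rightarrow> real \<Rightarrow> real ^ 'd \<Rightarrow> real \<Rightarrow> real ^ 'd \<Rightarrow> real"

definition density_kernel :: "('d::finite, 'l::finite) sde \<Rightarrow> 'd kernel \<Rightarrow> bool" where
  "density_kernel S p \<longleftrightarrow>
    (\<forall>i\<in>regime_set S. \<forall>j\<in>regime_set S. \<forall>t s. 0 \<le> t \<and> t < s \<and> s \<le> horizon S \<longrightarrow>
      (\<lambda>(x, y). p i j t x s y) \<in> borel_measurable (borel \<Otimes>\<^sub>M borel) \<and>
      (\<forall>x y. 0 \<le> p i j t x s y))"

text \<open>\<open>P(X\<^sub>s \<in> B, \<Lambda>\<^sub>s = j | (X\<^sub>t, \<Lambda>\<^sub>t) = (x,i)) = \<integral>\<^sub>B q\<^sub>i\<^sub>j(t,x,s,y) dy\<close> as a version of the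
  conditional probability, hence for \<open>P\<^sub>t\<close>-almost every \<open>(x,i)\<close>.\<close>

definition has_transition_density ::
    "('d::finite, 'l::finite) sde \<Rightarrow> (real \<Rightarrow> (real ^ 'd) \<times> nat) measure \<Rightarrow> 'd kernel \<Rightarrow> bool" where
  "has_transition_density S P q \<longleftrightarrow> density_kernel S q \<and>
    (\<forall>t s. \<forall>j\<in>regime_set S. \<forall>B\<in>sets borel. 0 \<le> t \<and> t < s \<and> s \<le> horizon S \<longrightarrow>
      (AE \<omega> in P.
        nn_cond_exp P (sigma_at S t) (indicator {\<eta> \<in> paths S. fst (\<eta> s) \<in> B \<and> snd (\<eta> s) = j}) \<omega> =
        (\<integral>\<^sup>+y\<in>B. ennreal (q (snd (\<omega> t)) j t (fst (\<omega> t)) s y) \<partial>lborel)))"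

text \<open>Since the density of \<open>R\<close> is required for every \<open>(x,i)\<close>, the conditional law of \<open>R\<close> given
  \<open>(X\<^sub>t, \<Lambda>\<^sub>t) = (x,i)\<close> is the one supplied by the Markov family, \<open>P\<^sup>t\<^sup>,\<^sup>x\<^sup>,\<^sup>i\<close>.\<close>

definition assumption_D1 ::
    "('d::finite, 'l::finite) sde \<Rightarrow>
      (real \<Rightarrow> real ^ 'd \<Rightarrow> nat \<Rightarrow> (real \<Rightarrow> (real ^ 'd) \<times> nat) measure) \<Rightarrow> 'd kernel \<Rightarrow> bool" where
  "assumption_D1 S PP p \<longleftrightarrow> density_kernel S p \<and>
    (\<forall>i\<in>regime_set S. \<forall>j\<in>regime_set S. \<forall>t s. 0 \<le> t \<and> t < s \<and> s \<le> horizon S \<longrightarrow>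
      (\<forall>x. \<forall>B\<in>sets borel.
        emeasure (PP t x i) {\<omega> \<in> paths S. fst (\<omega> s) \<in> B \<and> snd (\<omega> s) = j} =
        (\<integral>\<^sup>+y\<in>B. ennreal (p i j t x s y) \<partial>lborel)) \<and>
      bounded (range (\<lambda>(x, y). p i j t x s y)))"

definition assumption_D2 ::
    "('d::finite, 'l::finite) sde \<Rightarrow> ((real ^ 'd) \<times> nat) measure \<Rightarrow>
      ((real ^ 'd) \<times> nat \<Rightarrow> real) \<Rightarrow> ((real ^ 'd) \<times> nat \<Rightarrow> real) \<Rightarrow> bool" where
  "assumption_D2 S R0 f g \<longleftrightarrow>
    (\<forall>i\<in>regime_set S. (\<integral>\<^sup>+x. ennreal (f (x, i)) \<partial>slice R0 i) < \<infinity>) \<and>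
    (\<forall>j\<in>regime_set S. bounded (range (\<lambda>y. g (y, j))))"

definition potential ::
    "('d::finite, 'l::finite) sde \<Rightarrow> ((real ^ 'd) \<times> nat \<Rightarrow> real) \<Rightarrow> 'd kernel \<Rightarrow>
      real \<Rightarrow> real ^ 'd \<Rightarrow> nat \<Rightarrow> real" where
  "potential S g p t x i =
    (if t < horizon S
     then \<Sum>j\<in>regime_set S. \<integral>y. g (y, j) * p i j t x (horizon S) y \<partial>lborel
     else g (x, i))"

text \<open>Meaningful for \<open>0 < s\<close> only; at time \<open>0\<close> the backward potential is the measure
  \<open>f(y,j) R\<^sub>0(dy,j)\<close>.\<close>

definition copotential ::
    "('d::finite, 'l::finite) sde \<Rightarrow> ((real ^ 'd) \<times> nat) measure \<Rightarrow> ((real ^ 'd) \<times> nat \<Rightarrow> real) \<Rightarrow>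
      'd kernel \<Rightarrow> real \<Rightarrow> real ^ 'd \<Rightarrow> nat \<Rightarrow> real" where
  "copotential S R0 f p s y j =
    (\<Sum>i\<in>regime_set S. \<integral>x. f (x, i) * p i j 0 x s y \<partial>slice R0 i)"

end

theory Submission
  imports Defs
begin

text \<open>The strong Markov property of the family at deterministic times, integrated over the initial law,
  makes \<open>R\<close> a Markov process with transition density \<open>p\<close>. The bridge is then Doob's transform of
  \<open>R\<close>: given the path up to time \<open>t\<close>, the factor \<open>g(X\<^sub>T, \<Lambda>\<^sub>T)\<close> may be replaced by
  \<open>\<phi>(t, X\<^sub>t, \<Lambda>\<^sub>t)\<close>, so conditioning at \<open>t\<close> reweights \<open>p\<close> by the quotient of potentials, and the
  marginal at \<open>t\<close> follows by propagating \<open>f(X\<^sub>0, \<Lambda>\<^sub>0) R\<^sub>0\<close> forward with Fubini. Since \<open>R\<close> lives on the Borel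
  sets of the Skorokhod topology, all of this rests on the evaluations \<open>\<omega> \<mapsto> \<omega> t\<close> being Borel.\<close>

section \<open>Evaluation maps on Skorokhod space\<close>

text \<open>The map from \<open>(x, i)\<close> to \<open>PP t x i\<close> is not assumed to be
  measurable, and \<open>R\<close> is tied to the family only through conditional probabilities
  given the state at time 0. Markov identities are therefore stated as equalities of integrals
  against a test function \<open>U\<close> of the past, the one form that passes from each
  \<open>PP 0 x i\<close> to \<open>R\<close>. The function \<open>U\<close> is an arbitrary
  nonnegative function measurable up to time \<open>t\<close>, because it later has to carry
  \<open>f\<close> at time 0 together with indicators at \<open>t\<close> or at \<open>s\<close>.
  The calculations run in \<open>ennreal\<close>, where products, sums and Fubini need no
  integrability. Assumption (D2) and the bound on \<open>p\<close> enter where the Bochner integrals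
  that define the potentials are compared with nonnegative integrals; a failure of integrability
  would turn them into the default value 0. Evaluation at a fixed time is not continuous for the
  Skorokhod topology at interior times, so its measurability needs an argument. At the horizon,
  where no right limit exists, the argument is a different one.\<close>

lemma space_path_space: "space (path_space S) = paths S"
  unfolding path_space_def by (rule space_measure_of) (auto simp: skorokhod_open_def)

lemma skorokhod_open_in_sets: "skorokhod_open S U \<Longrightarrow> U \<in> sets (path_space S)"
  unfolding path_space_def by (subst sets_measure_of) (auto simp: skorokhod_open_def)

lemma space_state: "space (state S) = UNIV \<times> regime_set S"
  by (simp add: state_def space_pair_measure)

lemma finite_regime_set [simp, intro]: "finite (regime_set S)"
  by (simp add: regime_set_def)

lemma path_in_state:
  assumes "\<omega> \<in> paths S" "t \<in> {0..horizon S}"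
  shows "\<omega> t \<in> UNIV \<times> regime_set S"
  using assms unfolding paths_def by (auto dest!: PiE_mem)

text \<open>In \<open>skorokhod_open\<close> the regimes are coerced to real numbers.\<close>

definition embed_state :: "'a \<times> nat \<Rightarrow> 'a \<times> real" where
  "embed_state = (\<lambda>(x, j). (x, real j))"

text \<open>The regime component of a convergent family is eventually constant, since the naturals
  are discrete; hence limits survive the coercion.\<close>

lemma tendsto_embed_state:
  fixes h :: "real \<Rightarrow> 'a::topological_space \<times> nat"
  assumes "(h \<longlongrightarrow> z) F"
  shows "((\<lambda>u. embed_state (h u)) \<longlongrightarrow> embed_state z) F"
proof -
  have "eventually (\<lambda>u. snd (h u) = snd z) F"
    using tendsto_snd[OF assms] by (simp add: tendsto_discrete)
  then have "((\<lambda>u. real (snd (h u))) \<longlongrightarrow> real (snd z)) F"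
    by (intro tendsto_eventually) (auto elim: eventually_mono)
  then have "((\<lambda>u. (fst (h u), real (snd (h u)))) \<longlongrightarrow> (fst z, real (snd z))) F"
    by (intro tendsto_Pair tendsto_fst assms)
  then show ?thesis
    by (simp add: embed_state_def case_prod_unfold)
qed

lemma skorokhod_open_iff:
  "skorokhod_open S U \<longleftrightarrow> U \<subseteq> paths S \<and>
    (\<forall>\<omega>\<in>U. \<exists>e>0. \<forall>\<eta>\<in>paths S.
      skorokhod_close (horizon S) e (\<lambda>u. embed_state (\<omega> u)) (\<lambda>u. embed_state (\<eta> u)) \<longrightarrow> \<eta> \<in> U)"
  by (simp add: skorokhod_open_def embed_state_def)

text \<open>Confinement to \<open>F\<close> during \<open>[a, b]\<close> with a margin
  \<open>e\<close>, both in time and in space, that may depend on the path. Without the margin a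
  small time change could break confinement. For \<open>b < a\<close> a small margin makes the
  interval empty, so that every path qualifies.\<close>

definition stays :: "('d::finite, 'l::finite) sde \<Rightarrow> real \<Rightarrow> real \<Rightarrow> ((real ^ 'd) \<times> real) set \<Rightarrow>
    (real \<Rightarrow> (real ^ 'd) \<times> nat) set" where
  "stays S a b F = {\<omega> \<in> paths S. \<exists>e>0. \<forall>u\<in>{a - e..b + e} \<inter> {0..horizon S}. ball (embed_state (\<omega> u)) e \<subseteq> F}"

lemma staysI:
  assumes "\<omega> \<in> paths S" "e > 0"
    and "\<And>u. u \<in> {a - e..b + e} \<inter> {0..horizon S} \<Longrightarrow> ball (embed_state (\<omega> u)) e \<subseteq> F"
  shows "\<omega> \<in> stays S a b F"
  using assms unfolding stays_def by blast

lemma skorokhod_open_stays: "skorokhod_open S (stays S a b F)"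
  unfolding skorokhod_open_iff
proof (intro conjI ballI)
  show "stays S a b F \<subseteq> paths S" by (auto simp: stays_def)
  fix \<omega> assume "\<omega> \<in> stays S a b F"
  then obtain e where e: "e > 0" "\<forall>u\<in>{a - e..b + e} \<inter> {0..horizon S}. ball (embed_state (\<omega> u)) e \<subseteq> F"
    by (auto simp: stays_def)
  show "\<exists>e>0. \<forall>\<eta>\<in>paths S. skorokhod_close (horizon S) e (\<lambda>u. embed_state (\<omega> u)) (\<lambda>u. embed_state (\<eta> u)) \<longrightarrow> \<eta> \<in> stays S a b F"
  \<comment> \<open>One half of the margin absorbs the time change and the displacement in space;
    the other half is left as the margin of \<open>\<eta>\<close>.\<close>
  proof (intro exI[of _ "e / 2"] conjI ballI impI)
    fix \<eta> assume \<eta>: "\<eta> \<in> paths S" and "skorokhod_close (horizon S) (e / 2) (\<lambda>u. embed_state (\<omega> u)) (\<lambda>u. embed_state (\<eta> u))"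
    then obtain l where l: "l ` {0..horizon S} = {0..horizon S}"
        "\<forall>t\<in>{0..horizon S}. \<bar>l t - t\<bar> < e / 2 \<and> dist (embed_state (\<omega> (l t))) (embed_state (\<eta> t)) < e / 2"
      by (auto simp: skorokhod_close_def)
    have "ball (embed_state (\<eta> u)) (e / 2) \<subseteq> F" if u: "u \<in> {a - e / 2..b + e / 2} \<inter> {0..horizon S}" for u
    proof -
      have *: "\<bar>l u - u\<bar> < e / 2" "dist (embed_state (\<omega> (l u))) (embed_state (\<eta> u)) < e / 2" "l u \<in> {0..horizon S}"
        using l u by auto
      then have "l u \<in> {a - e..b + e}"
        using u unfolding abs_less_iff by auto
      then have "ball (embed_state (\<omega> (l u))) e \<subseteq> F"
        using e(2) *(3) by blast
      moreover have "ball (embed_state (\<eta> u)) (e / 2) \<subseteq> ball (embed_state (\<omega> (l u))) e"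
        using *(2) by (simp add: ball_subset_ball_iff dist_commute)
      ultimately show ?thesis by blast
    qed
    then show "\<eta> \<in> stays S a b F"
      using \<eta> e(1) by (intro staysI[of \<eta> S "e / 2"]) auto
  qed (use e in auto)
qed

text \<open>These sets approximate an open \<open>U\<close> from inside as \<open>r\<close>
  decreases. Being closed, they retain the right limit of a path confined to them, which
  \<open>U\<close> itself need not do.\<close>

lemma closed_ball_subset: "closed {x :: 'a :: metric_space. ball x r \<subseteq> U}"
  unfolding closed_sequential_limits
proof (intro allI impI, elim conjE)
  fix x and l :: 'a
  assume x: "\<forall>n. x n \<in> {x. ball x r \<subseteq> U}" "x \<longlonglongrightarrow> l"
  have "y \<in> U" if "dist l y < r" for y
  proof -
    have "(\<lambda>n. dist (x n) y) \<longlonglongrightarrow> dist l y"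
      using x(2) by (intro tendsto_intros)
    then have "eventually (\<lambda>n. dist (x n) y < r) sequentially"
      using that by (rule order_tendstoD(2))
    then obtain n where "dist (x n) y < r"
      by (auto simp: eventually_sequentially)
    then show ?thesis using x(1) by (auto simp: subset_iff)
  qed
  then show "l \<in> {x. ball x r \<subseteq> U}" by auto
qed

text \<open>Right continuity reads off \<open>\<omega> t\<close> from the values of \<open>\<omega>\<close> on the intervals \<open>[t + 1/m, t + 1/n]\<close>,
  and confinement on such an interval is a Skorokhod open condition.\<close>

lemma evaluation_open_eq:
  fixes U :: "((real ^ 'd::finite) \<times> real) set"
  assumes t: "0 \<le> t" "t < horizon S" and U: "open U"
  shows "{\<omega> \<in> paths S. embed_state (\<omega> t) \<in> U} =
    (\<Union>k::nat. \<Union>n::nat. \<Inter>m::nat.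
      stays S (t + inverse (Suc m)) (t + inverse (Suc n)) {x. ball x (inverse (Suc k)) \<subseteq> U})"
    (is "?L = ?R")
proof (intro equalityI subsetI)
  fix \<omega> assume "\<omega> \<in> ?L"
  then have \<omega>: "\<omega> \<in> paths S" "embed_state (\<omega> t) \<in> U" by auto
  obtain r where r: "r > 0" "ball (embed_state (\<omega> t)) r \<subseteq> U"
    using U \<omega>(2) open_contains_ball by blast
  have "((\<lambda>u. embed_state (\<omega> u)) \<longlongrightarrow> embed_state (\<omega> t)) (at_right t)"
    using \<omega>(1) t by (intro tendsto_embed_state) (auto simp: paths_def)
  then have "eventually (\<lambda>u. dist (embed_state (\<omega> u)) (embed_state (\<omega> t)) < r / 3) (at_right t)"
    by (rule tendstoD) (use r in auto)
  then obtain d where d: "d > t" "\<And>u. t < u \<Longrightarrow> u < d \<Longrightarrow> dist (embed_state (\<omega> u)) (embed_state (\<omega> t)) < r / 3"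
    unfolding eventually_at_right_field by auto
  \<comment> \<open>The radius \<open>r\<close> is spent in thirds: on the oscillation of
    \<open>\<omega>\<close> to the right of \<open>t\<close>, on the margin in space, and on the
    radius of the inner approximation.\<close>
  obtain k where k: "inverse (real (Suc k)) < r / 3"
    using reals_Archimedean[of "r / 3"] r by auto
  \<comment> \<open>Half of \<open>d - t\<close>, because the margin in time may almost double the
    length \<open>inverse (Suc n)\<close>.\<close>
  obtain n where n: "inverse (real (Suc n)) < (d - t) / 2"
    using reals_Archimedean[of "(d - t) / 2"] d by auto
  have "\<omega> \<in> stays S (t + inverse (Suc m)) (t + inverse (Suc n)) {x. ball x (inverse (Suc k)) \<subseteq> U}" for m
  proof -
    \<comment> \<open>A margin below \<open>inverse (Suc m)\<close> keeps the enlarged interval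
      strictly to the right of \<open>t\<close>, where right continuity controls the path.\<close>
    define e where "e = min (inverse (Suc m)) (min (inverse (Suc n)) (r / 3)) / 2"
    have e: "0 < e" "e < inverse (real (Suc m))" "e < inverse (real (Suc n))" "e < r / 3"
    proof -
      have pos: "0 < inverse (real (Suc m))" "0 < inverse (real (Suc n))" by simp_all
      show "0 < e" "e < inverse (real (Suc m))" "e < inverse (real (Suc n))" "e < r / 3"
        using r(1) pos unfolding e_def by linarith+
    qed
    have "ball y (inverse (Suc k)) \<subseteq> U"
      if u: "u \<in> {t + inverse (Suc m) - e..t + inverse (Suc n) + e}" and y: "dist (embed_state (\<omega> u)) y < e" for u y
    proof -
      have "t < u" "u < d" using u e n by auto
      then have "dist (embed_state (\<omega> u)) (embed_state (\<omega> t)) < r / 3" by (rule d(2))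
      then have "dist y (embed_state (\<omega> t)) < 2 * (r / 3)"
        using y e(4) dist_triangle[of y "embed_state (\<omega> t)" "embed_state (\<omega> u)"] by (simp add: dist_commute)
      then have "ball y (inverse (Suc k)) \<subseteq> ball (embed_state (\<omega> t)) r"
        using k by (simp add: ball_subset_ball_iff)
      then show ?thesis using r(2) by blast
    qed
    then show ?thesis
      using \<omega>(1) e(1) by (intro staysI[of \<omega> S e]) (metis IntD1 mem_ball mem_Collect_eq subsetI)+
  qed
  then show "\<omega> \<in> ?R" by blast
next
  fix \<omega> assume "\<omega> \<in> ?R"
  then obtain k n where *: "\<And>m. \<omega> \<in> stays S (t + inverse (real (Suc m))) (t + inverse (real (Suc n)))
      {x. ball x (inverse (real (Suc k))) \<subseteq> U}"
    by blast
  then have \<omega>: "\<omega> \<in> paths S" by (auto simp: stays_def)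
  let ?F = "{x. ball x (inverse (real (Suc k))) \<subseteq> U}"
  have lim: "((\<lambda>u. embed_state (\<omega> u)) \<longlongrightarrow> embed_state (\<omega> t)) (at_right t)"
    using \<omega>(1) t by (intro tendsto_embed_state) (auto simp: paths_def)
  have "embed_state (\<omega> u) \<in> ?F" if u: "t < u" "u < min (t + inverse (real (Suc n))) (horizon S)" for u
  proof -
    \<comment> \<open>The intersection over all \<open>m\<close> is used here: every
      \<open>u\<close> close to \<open>t\<close> on the right lies beyond
      \<open>t + inverse (Suc m)\<close> for some \<open>m\<close>, so confinement holds on a full
      right neighbourhood of \<open>t\<close>.\<close>
    obtain m where m: "inverse (real (Suc m)) < u - t"
      using reals_Archimedean[of "u - t"] u by auto
    obtain e where e: "e > 0"
        "\<forall>u\<in>{t + inverse (real (Suc m)) - e..t + inverse (real (Suc n)) + e} \<inter> {0..horizon S}. ball (embed_state (\<omega> u)) e \<subseteq> ?F"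
      using *[of m] unfolding stays_def by blast
    have "u \<in> {t + inverse (real (Suc m)) - e..t + inverse (real (Suc n)) + e} \<inter> {0..horizon S}"
      using u m e(1) t by auto
    then have "ball (embed_state (\<omega> u)) e \<subseteq> ?F" using e(2) by blast
    then show ?thesis using e(1) by (meson centre_in_ball subsetD)
  qed
  then have "eventually (\<lambda>u. embed_state (\<omega> u) \<in> ?F) (at_right t)"
    unfolding eventually_at_right_field using t
    by (intro exI[of _ "min (t + inverse (real (Suc n))) (horizon S)"]) auto
  then have "embed_state (\<omega> t) \<in> ?F"
    by (intro Lim_in_closed_set[OF closed_ball_subset _ _ lim]) auto
  then have "embed_state (\<omega> t) \<in> U" by auto
  then show "\<omega> \<in> ?L" using \<omega> by auto
qed

text \<open>Time changes fix the horizon, so closeness of two paths bounds the distance of their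
  terminal values: evaluation there is continuous.\<close>

lemma skorokhod_open_evaluation_horizon:
  assumes T: "0 < horizon S" and U: "open U"
  shows "skorokhod_open S {\<omega> \<in> paths S. embed_state (\<omega> (horizon S)) \<in> U}"
  unfolding skorokhod_open_iff
proof (intro conjI ballI)
  fix \<omega> assume "\<omega> \<in> {\<omega> \<in> paths S. embed_state (\<omega> (horizon S)) \<in> U}"
  then obtain r where r: "r > 0" "ball (embed_state (\<omega> (horizon S))) r \<subseteq> U"
    using U open_contains_ball by blast
  show "\<exists>e>0. \<forall>\<eta>\<in>paths S. skorokhod_close (horizon S) e (\<lambda>u. embed_state (\<omega> u)) (\<lambda>u. embed_state (\<eta> u)) \<longrightarrow> \<eta> \<in> {\<omega> \<in> paths S. embed_state (\<omega> (horizon S)) \<in> U}"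
  proof (intro exI[of _ r] conjI ballI impI)
    fix \<eta> assume \<eta>: "\<eta> \<in> paths S" and "skorokhod_close (horizon S) r (\<lambda>u. embed_state (\<omega> u)) (\<lambda>u. embed_state (\<eta> u))"
    then obtain l where l: "strict_mono_on {0..horizon S} l" "l ` {0..horizon S} = {0..horizon S}"
        "\<forall>t\<in>{0..horizon S}. \<bar>l t - t\<bar> < r \<and> dist (embed_state (\<omega> (l t))) (embed_state (\<eta> t)) < r"
      by (auto simp: skorokhod_close_def)
    \<comment> \<open>An increasing map of \<open>[0, T]\<close> onto itself attains
      \<open>T\<close> somewhere, hence at the right end point.\<close>
    have "l (horizon S) = horizon S"
    proof (rule antisym)
      obtain v where v: "v \<in> {0..horizon S}" "l v = horizon S"
        using l(2) T by (metis (no_types, lifting) atLeastAtMost_iff imageE less_eq_real_def)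
      have "l v \<le> l (horizon S)"
        using v T by (intro monotone_onD[OF strict_mono_on_imp_mono_on[OF l(1)]]) auto
      then show "horizon S \<le> l (horizon S)" using v by simp
      have "l (horizon S) \<in> l ` {0..horizon S}" using T by auto
      then show "l (horizon S) \<le> horizon S" using l(2) by simp
    qed
    then have "dist (embed_state (\<omega> (horizon S))) (embed_state (\<eta> (horizon S))) < r"
      using l(3) T by (metis atLeastAtMost_iff less_eq_real_def)
    then show "\<eta> \<in> {\<omega> \<in> paths S. embed_state (\<omega> (horizon S)) \<in> U}"
      using \<eta> r by auto
  qed (rule r)
qed auto

lemma evaluation_open_in_sets:
  fixes U :: "((real ^ 'd::finite) \<times> real) set"
  assumes t: "t \<in> {0..horizon S}" and T: "0 < horizon S" and U: "open U"
  shows "{\<omega> \<in> paths S. embed_state (\<omega> t) \<in> U} \<in> sets (path_space S)"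
proof (cases "t = horizon S")
  case True
  then show ?thesis
    using skorokhod_open_in_sets[OF skorokhod_open_evaluation_horizon[OF T U]] by simp
next
  case False
  then have t: "0 \<le> t" "t < horizon S" using t by auto
  show ?thesis
    unfolding evaluation_open_eq[OF t U]
    by (intro sets.countable_UN sets.countable_INT image_subsetI skorokhod_open_in_sets
        skorokhod_open_stays) auto
qed

lemma measurable_evaluation:
  fixes S :: "('d::finite, 'l::finite) sde"
  assumes t: "t \<in> {0..horizon S}" and T: "0 < horizon S"
  shows "(\<lambda>\<omega>. \<omega> t) \<in> measurable (path_space S) (state S)"
proof -
  have 1: "(\<lambda>\<omega>. fst (\<omega> t)) \<in> borel_measurable (path_space S)"
  proof (rule borel_measurableI)
    fix A :: "(real ^ 'd) set" assume "open A"
    then have "{\<omega> \<in> paths S. embed_state (\<omega> t) \<in> A \<times> UNIV} \<in> sets (path_space S)"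
      by (intro evaluation_open_in_sets t T open_Times) auto
    also have "{\<omega> \<in> paths S. embed_state (\<omega> t) \<in> A \<times> UNIV} = (\<lambda>\<omega>. fst (\<omega> t)) -` A \<inter> space (path_space S)"
      by (auto simp: space_path_space embed_state_def case_prod_unfold)
    finally show "(\<lambda>\<omega>. fst (\<omega> t)) -` A \<inter> space (path_space S) \<in> sets (path_space S)" .
  qed
  have 2: "(\<lambda>\<omega>. snd (\<omega> t)) \<in> measurable (path_space S) (count_space (regime_set S))"
    unfolding measurable_count_space_eq2[OF finite_regime_set]
  proof (intro conjI ballI)
    show "(\<lambda>\<omega>. snd (\<omega> t)) \<in> space (path_space S) \<rightarrow> regime_set S"
      using path_in_state[OF _ t] by (auto simp: space_path_space mem_Times_iff)
    fix j
    \<comment> \<open>The open interval of radius 1 isolates \<open>j\<close> among the coerced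
      regimes.\<close>
    have "{\<omega> \<in> paths S. embed_state (\<omega> t) \<in> UNIV \<times> {real j - 1<..<real j + 1}} \<in> sets (path_space S)"
      by (intro evaluation_open_in_sets t T open_Times) auto
    also have "{\<omega> \<in> paths S. embed_state (\<omega> t) \<in> UNIV \<times> {real j - 1<..<real j + 1}} = (\<lambda>\<omega>. snd (\<omega> t)) -` {j} \<inter> space (path_space S)"
      by (auto simp: space_path_space embed_state_def case_prod_unfold)
    finally show "(\<lambda>\<omega>. snd (\<omega> t)) -` {j} \<inter> space (path_space S) \<in> sets (path_space S)" .
  qed
  show ?thesis
    unfolding state_def
    by (rule measurable_pair) (use 1 2 in \<open>simp_all add: o_def\<close>)
qed

lemma freeze_in_paths:
  assumes \<omega>: "\<omega> \<in> paths S" and t: "t \<in> {0..horizon S}"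
  shows "freeze (horizon S) t \<omega> \<in> paths S"
proof -
  let ?T = "horizon S" and ?\<eta> = "freeze (horizon S) t \<omega>"
  have \<eta>: "?\<eta> r = \<omega> (max t r)" if "0 \<le> r" "r \<le> ?T" for r
    using that by (simp add: freeze_def)
  have r: "(?\<eta> \<longlongrightarrow> ?\<eta> r) (at_right r)" if "0 \<le> r" "r < ?T" for r
  proof (cases "r < t")
    case True
    have "eventually (\<lambda>u. ?\<eta> u = \<omega> t) (at_right r)"
      unfolding eventually_at_right_field using True t that
      by (intro exI[of _ t]) (auto simp: \<eta>)
    moreover have "?\<eta> r = \<omega> t" using True that by (simp add: \<eta>)
    ultimately show ?thesis by (auto intro: tendsto_eventually)
  next
    case False
    then have "(\<omega> \<longlongrightarrow> \<omega> r) (at_right r)"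
      using \<omega> that by (auto simp: paths_def)
    moreover have "eventually (\<lambda>u. \<omega> u = ?\<eta> u) (at_right r)"
      unfolding eventually_at_right_field using False that
      by (intro exI[of _ ?T]) (auto simp: \<eta> max_def)
    ultimately show ?thesis
      using False that by (simp add: \<eta> max_def tendsto_cong)
  qed
  have l: "\<exists>l. (?\<eta> \<longlongrightarrow> l) (at_left r)" if "0 < r" "r \<le> ?T" for r
  proof (cases "r \<le> t")
    case True
    have "eventually (\<lambda>u. ?\<eta> u = \<omega> t) (at_left r)"
      unfolding eventually_at_left_field using True t that
      by (intro exI[of _ 0]) (auto simp: \<eta> max_def)
    then show ?thesis by (intro exI[of _ "\<omega> t"] tendsto_eventually)
  next
    case False
    have "\<exists>l. (\<omega> \<longlongrightarrow> l) (at_left r)"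
      using \<omega> that by (simp add: paths_def)
    then obtain l where "(\<omega> \<longlongrightarrow> l) (at_left r)" ..
    moreover have "eventually (\<lambda>u. \<omega> u = ?\<eta> u) (at_left r)"
      unfolding eventually_at_left_field using False that t
      by (intro exI[of _ t]) (auto simp: \<eta> max_def)
    ultimately show ?thesis by (intro exI[of _ l]) (simp add: tendsto_cong)
  qed
  have "?\<eta> \<in> {0..?T} \<rightarrow>\<^sub>E UNIV \<times> regime_set S"
  proof (rule PiE_I)
    show "?\<eta> u \<in> UNIV \<times> regime_set S" if "u \<in> {0..?T}" for u
      using path_in_state[OF \<omega>, of "max t u"] that t by (simp add: \<eta> le_max_iff_disj)
  qed (auto simp: freeze_def)
  with r l show ?thesis
    unfolding paths_def by auto
qed

section \<open>Filtrations and transition operators\<close>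

lemma space_natural_filtration: "space (natural_filtration S t) = paths S"
  unfolding natural_filtration_def by (rule space_measure_of) auto

lemma sets_natural_filtration:
  "sets (natural_filtration S t) = sigma_sets (paths S)
    {(\<lambda>\<omega>. \<omega> u) -` A \<inter> paths S | u A. u \<in> {0..horizon S} \<and> u \<le> t \<and> A \<in> sets (state S)}"
  unfolding natural_filtration_def by (rule sets_measure_of) auto

lemma filtration_natural_filtration: "filtration (paths S) (natural_filtration S)"
proof
  show "space (natural_filtration S i) = paths S" for i
    by (rule space_natural_filtration)
  show "sets (natural_filtration S i) \<subseteq> sets (natural_filtration S j)" if "i \<le> j" for i j
    unfolding sets_natural_filtration by (intro sigma_sets_mono' Collect_mono impI, elim exE conjE)
      (intro exI conjI, assumption+, rule order_trans[OF _ that])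
qed

lemma measurable_evaluation_natural_filtration:
  assumes u: "u \<in> {0..horizon S}" "u \<le> t"
  shows "(\<lambda>\<omega>. \<omega> u) \<in> measurable (natural_filtration S t) (state S)"
proof (rule measurableI)
  show "\<omega> u \<in> space (state S)" if "\<omega> \<in> space (natural_filtration S t)" for \<omega>
    using path_in_state[OF _ u(1)] that by (simp add: space_natural_filtration space_state)
  show "(\<lambda>\<omega>. \<omega> u) -` A \<inter> space (natural_filtration S t) \<in> sets (natural_filtration S t)"
    if "A \<in> sets (state S)" for A
    unfolding space_natural_filtration sets_natural_filtration using u that
    by (intro sigma_sets.Basic) blast
qed

lemma subalgebra_natural_filtration:
  assumes "0 < horizon S"
  shows "subalgebra (path_space S) (natural_filtration S t)"
  unfolding subalgebra_def
proof
  have "(\<lambda>\<omega>. \<omega> u) -` A \<inter> paths S \<in> sets (path_space S)"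
    if "u \<in> {0..horizon S}" "A \<in> sets (state S)" for u A
    using measurable_sets[OF measurable_evaluation[OF that(1) assms] that(2)]
    by (simp add: space_path_space)
  then show "sets (natural_filtration S t) \<subseteq> sets (path_space S)"
    unfolding sets_natural_filtration space_path_space[symmetric]
    by (intro sets.sigma_sets_subset) (auto simp: space_path_space)
qed (simp add: space_natural_filtration space_path_space)

text \<open>With a constant stopping time the strong Markov property becomes the ordinary one. The
  part of \<open>A\<close> on which the time is at most \<open>t\<close> is either all of
  \<open>A\<close> or empty.\<close>

lemma sets_pre_sigma_const:
  assumes "filtration \<Omega> F"
  shows "sets (filtration.pre_sigma \<Omega> F (\<lambda>_. c)) = sets (F c)"
proof -
  interpret filtration \<Omega> F by fact
  have "{\<omega> \<in> A. c \<le> t} \<in> sets (F t)" if "A \<in> sets (F c)" for A t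
    using that sets_F_mono[of c t] by (cases "c \<le> t") auto
  moreover have "A \<in> sets (F c)" if "\<forall>t. {\<omega> \<in> A. c \<le> t} \<in> sets (F t)" for A
    using that[rule_format, of c] by simp
  ultimately show ?thesis
    unfolding sets_pre_sigma[OF stopping_time_const] by blast
qed

section \<open>Conditioning on the state at a single time\<close>

lemma space_sigma_at: "space (sigma_at S t) = paths S"
  by (simp add: sigma_at_def)

lemma measurable_sigma_at:
  assumes "t \<in> {0..horizon S}"
  shows "(\<lambda>\<omega>. \<omega> t) \<in> measurable (sigma_at S t) (state S)"
  unfolding sigma_at_def
  by (rule measurable_vimage_algebra1) (use path_in_state[OF _ assms] in \<open>auto simp: space_state\<close>)

lemma sets_sigma_at:
  assumes "t \<in> {0..horizon S}"
  shows "sets (sigma_at S t) = {(\<lambda>\<omega>. \<omega> t) -` A \<inter> paths S | A. A \<in> sets (state S)}"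
  unfolding sigma_at_def
  by (rule sets_vimage_algebra2) (use path_in_state[OF _ assms] in \<open>auto simp: space_state\<close>)

lemma subalgebra_sigma_at:
  assumes "t \<in> {0..horizon S}" "0 < horizon S"
  shows "subalgebra (path_space S) (sigma_at S t)"
  unfolding subalgebra_def
proof
  have "(\<lambda>\<omega>. \<omega> t) -` A \<inter> paths S \<in> sets (path_space S)" if "A \<in> sets (state S)" for A
    using measurable_sets[OF measurable_evaluation[OF assms] that] by (simp add: space_path_space)
  then show "sets (sigma_at S t) \<subseteq> sets (path_space S)"
    unfolding sets_sigma_at[OF assms(1)] by auto
qed (simp add: space_sigma_at space_path_space)

section \<open>Regime-wise integration and transition operators on the state space\<close>

lemma sigma_finite_state: "sigma_finite_measure (state S)"
proof -
  interpret pair_sigma_finite lborel "count_space (regime_set S)"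
    by (intro pair_sigma_finite.intro lborel.sigma_finite_measure_axioms
        sigma_finite_measure_count_space_finite finite_regime_set)
  show ?thesis unfolding state_def by (rule sigma_finite_measure_axioms)
qed

lemma sets_state: "sets (state S) = sets (borel \<Otimes>\<^sub>M count_space (regime_set S))"
  unfolding state_def by (intro sets_pair_measure_cong) auto

lemma measurable_fst_state [measurable]: "fst \<in> borel_measurable (state S)"
  and measurable_snd_state [measurable]: "snd \<in> measurable (state S) (count_space (regime_set S))"
  by (simp_all add: measurable_cong_sets[OF sets_state refl])

lemma measurable_Pair_state [measurable]:
  assumes [measurable]: "h \<in> borel_measurable M" "k \<in> measurable M (count_space (regime_set S))"
  shows "(\<lambda>x. (h x, k x)) \<in> measurable M (state S)"
  by (simp add: measurable_cong_sets[OF refl sets_state])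

lemma measurable_Pair_regime:
  assumes "j \<in> regime_set S"
  shows "(\<lambda>x. (x, j)) \<in> measurable borel (state S)"
  using assms by (intro measurable_Pair_state) auto

lemma nn_integral_state:
  assumes h: "h \<in> borel_measurable (state S)"
  shows "(\<integral>\<^sup>+w. h w \<partial>state S) = (\<Sum>j\<in>regime_set S. \<integral>\<^sup>+x. h (x, j) \<partial>lborel)"
proof -
  interpret pair_sigma_finite lborel "count_space (regime_set S)"
    by (intro pair_sigma_finite.intro lborel.sigma_finite_measure_axioms
        sigma_finite_measure_count_space_finite finite_regime_set)
  have "(\<integral>\<^sup>+w. h w \<partial>state S) = (\<integral>\<^sup>+j. \<integral>\<^sup>+x. h (x, j) \<partial>lborel \<partial>count_space (regime_set S))"
    unfolding state_def by (rule nn_integral_snd[symmetric]) (use h in \<open>simp add: state_def\<close>)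
  then show ?thesis by (simp add: nn_integral_count_space_finite)
qed

lemma Times_regime_in_sets_state:
  assumes "B \<in> sets borel" "j \<in> regime_set S"
  shows "B \<times> {j} \<in> sets (state S)"
  unfolding sets_state using assms by (intro pair_measureI) auto

text \<open>A measurable set is a finite disjoint union of pieces \<open>B \<times> {j}\<close>, so
  additivity suffices; no generator argument, and hence no finiteness of the measures, is
  involved.\<close>

lemma measure_state_eqI:
  assumes M: "sets M = sets (state S)" and N: "sets N = sets (state S)"
    and eq: "\<And>B j. B \<in> sets borel \<Longrightarrow> j \<in> regime_set S \<Longrightarrow> emeasure M (B \<times> {j}) = emeasure N (B \<times> {j})"
  shows "M = N"
proof (rule measure_eqI)
  fix A assume "A \<in> sets M"
  then have A: "A \<in> sets (state S)" by (simp add: M)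
  let ?B = "\<lambda>j. (\<lambda>x. (x, j)) -` A"
  have B: "?B j \<in> sets borel" if "j \<in> regime_set S" for j
    using measurable_sets[OF measurable_Pair_regime[OF that] A] by simp
  have split: "A = (\<Union>j\<in>regime_set S. ?B j \<times> {j})"
    using sets.sets_into_space[OF A] by (auto simp: space_state)
  have "emeasure K A = (\<Sum>j\<in>regime_set S. emeasure K (?B j \<times> {j}))" if "sets K = sets (state S)" for K
    by (subst split, rule sum_emeasure[symmetric])
      (auto simp: disjoint_family_on_def that intro!: Times_regime_in_sets_state B)
  then show "emeasure M A = emeasure N A"
    using M N eq[OF B] by simp
qed (simp add: M N)

definition transition :: "'d::finite kernel \<Rightarrow> real \<Rightarrow> real \<Rightarrow> (real ^ 'd) \<times> nat \<Rightarrow> (real ^ 'd) \<times> nat \<Rightarrow> ennreal"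
  where "transition p t s z w = ennreal (p (snd z) (snd w) t (fst z) s (fst w))"

text \<open>The transition operator from \<open>t\<close> to \<open>s\<close> acting on functions.
  Integrating against \<open>state S\<close> merges the sum over regimes and the Lebesgue
  integral.\<close>

definition propagate :: "('d::finite, 'l::finite) sde \<Rightarrow> 'd kernel \<Rightarrow> real \<Rightarrow> real \<Rightarrow>
    ((real ^ 'd) \<times> nat \<Rightarrow> ennreal) \<Rightarrow> (real ^ 'd) \<times> nat \<Rightarrow> ennreal" where
  "propagate S p t s h z = (\<integral>\<^sup>+w. h w * transition p t s z w \<partial>state S)"

text \<open>The kernel is measurable in the positions for each fixed pair of regimes; both regimes
  range over a finite set, so they can be substituted one after the other.\<close>

lemma measurable_transition:
  assumes p: "density_kernel S p" and ts: "0 \<le> t" "t < s" "s \<le> horizon S"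
    and zw: "z \<in> measurable M (state S)" "w \<in> measurable M (state S)"
  shows "(\<lambda>q. transition p t s (z q) (w q)) \<in> borel_measurable M"
proof -
  note [measurable] = zw
  have "(\<lambda>q. ennreal (p i j t (fst (z q)) s (fst (w q)))) \<in> borel_measurable M"
    if "i \<in> regime_set S" "j \<in> regime_set S" for i j
  proof -
    have "(\<lambda>(x, y). p i j t x s y) \<in> borel_measurable (borel \<Otimes>\<^sub>M borel)"
      using p that ts by (auto simp: density_kernel_def)
    from measurable_compose[OF _ this, of "\<lambda>q. (fst (z q), fst (w q))" M]
    show ?thesis by simp
  qed
  then have *: "(\<lambda>q. ennreal (p i (snd (w q)) t (fst (z q)) s (fst (w q)))) \<in> borel_measurable M"
    if "i \<in> regime_set S" for i
    using that
    by (intro measurable_compose_countable'[where I = "regime_set S" and g = "\<lambda>q. snd (w q)"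
          and f = "\<lambda>j q. ennreal (p i j t (fst (z q)) s (fst (w q)))"] countable_finite
          finite_regime_set measurable_compose[OF zw(2) measurable_snd_state])
  show ?thesis
    unfolding transition_def
    by (intro measurable_compose_countable'[where I = "regime_set S" and g = "\<lambda>q. snd (z q)"
          and f = "\<lambda>i q. ennreal (p i (snd (w q)) t (fst (z q)) s (fst (w q)))"] countable_finite
          finite_regime_set measurable_compose[OF zw(1) measurable_snd_state] *)
qed

lemma measurable_propagate:
  assumes p: "density_kernel S p" and ts: "0 \<le> t" "t < s" "s \<le> horizon S"
    and h [measurable]: "h \<in> borel_measurable (state S)"
  shows "propagate S p t s h \<in> borel_measurable (state S)"
proof -
  interpret sigma_finite_measure "state S" by (rule sigma_finite_state)
  note [measurable] = measurable_transition[OF p ts]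
  show ?thesis unfolding propagate_def by measurable
qed

section \<open>The Markov property of the family\<close>

text \<open>The kernel \<open>K\<close> is not assumed to be measurable, so its integrals are matched with a measurable
  function only almost everywhere.\<close>

lemma nn_integral_disintegration:
  assumes fin: "finite_measure_subalgebra R F"
    and K: "\<And>\<omega>. \<omega> \<in> space R \<Longrightarrow> sets (K \<omega>) = sets R"
    and cond: "\<And>A. A \<in> sets R \<Longrightarrow> AE \<omega> in R. nn_cond_exp R F (indicator A) \<omega> = emeasure (K \<omega>) A"
    and h: "h \<in> borel_measurable R"
  shows "\<exists>G \<in> borel_measurable R. (AE \<omega> in R. G \<omega> = (\<integral>\<^sup>+\<eta>. h \<eta> \<partial>K \<omega>)) \<and>
    (\<integral>\<^sup>+\<omega>. G \<omega> \<partial>R) = (\<integral>\<^sup>+\<omega>. h \<omega> \<partial>R)"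
proof -
  interpret finite_measure_subalgebra R F by fact
  have meas: "borel_measurable (K \<omega>) = borel_measurable R" if "\<omega> \<in> space R" for \<omega>
    by (rule measurable_cong_sets[OF K[OF that] refl])
  show ?thesis
    using h
  proof (induction rule: borel_measurable_induct)
    case (cong f g)
    have "(\<integral>\<^sup>+\<eta>. g \<eta> \<partial>K \<omega>) = (\<integral>\<^sup>+\<eta>. f \<eta> \<partial>K \<omega>)" if "\<omega> \<in> space R" for \<omega>
      by (rule nn_integral_cong) (use cong(3) sets_eq_imp_space_eq[OF K[OF that]] in auto)
    moreover have "(\<integral>\<^sup>+\<omega>. g \<omega> \<partial>R) = (\<integral>\<^sup>+\<omega>. f \<omega> \<partial>R)"
      by (rule nn_integral_cong) (use cong(3) in auto)
    ultimately show ?case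
      using cong(4) by (auto elim!: AE_mp intro!: AE_I2)
  next
    \<comment> \<open>The conditional probability itself is the measurable version sought, and
      taking a conditional expectation preserves the total integral.\<close>
    case (set A)
    have "AE \<omega> in R. nn_cond_exp R F (indicator A) \<omega> = (\<integral>\<^sup>+\<eta>. indicator A \<eta> \<partial>K \<omega>)"
      using cond[OF set] by (rule AE_mp) (intro AE_I2 impI, simp add: K set)
    moreover have "(\<integral>\<^sup>+\<omega>. nn_cond_exp R F (indicator A) \<omega> \<partial>R) = (\<integral>\<^sup>+\<omega>. indicator A \<omega> \<partial>R)"
      using nn_cond_exp_intg[of "\<lambda>_. 1" "indicator A"] set by simp
    ultimately show ?case
      by (intro bexI[of _ "nn_cond_exp R F (indicator A)"]) auto
  next
    case (mult u c)
    then obtain G where [measurable]: "G \<in> borel_measurable R"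
      and G: "AE \<omega> in R. G \<omega> = (\<integral>\<^sup>+\<eta>. u \<eta> \<partial>K \<omega>)" "(\<integral>\<^sup>+\<omega>. G \<omega> \<partial>R) = (\<integral>\<^sup>+\<omega>. u \<omega> \<partial>R)"
      by auto
    have "AE \<omega> in R. c * G \<omega> = (\<integral>\<^sup>+\<eta>. c * u \<eta> \<partial>K \<omega>)"
      using G(1) by (rule AE_mp) (intro AE_I2 impI, simp add: nn_integral_cmult meas mult)
    moreover have "(\<integral>\<^sup>+\<omega>. c * G \<omega> \<partial>R) = (\<integral>\<^sup>+\<omega>. c * u \<omega> \<partial>R)"
      using G(2) mult by (simp add: nn_integral_cmult)
    ultimately show ?case
      by (intro bexI[of _ "\<lambda>\<omega>. c * G \<omega>"]) auto
  next
    case (add u v)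
    then obtain G H where [measurable]: "G \<in> borel_measurable R" "H \<in> borel_measurable R"
      and G: "AE \<omega> in R. G \<omega> = (\<integral>\<^sup>+\<eta>. u \<eta> \<partial>K \<omega>)" "(\<integral>\<^sup>+\<omega>. G \<omega> \<partial>R) = (\<integral>\<^sup>+\<omega>. u \<omega> \<partial>R)"
      and H: "AE \<omega> in R. H \<omega> = (\<integral>\<^sup>+\<eta>. v \<eta> \<partial>K \<omega>)" "(\<integral>\<^sup>+\<omega>. H \<omega> \<partial>R) = (\<integral>\<^sup>+\<omega>. v \<omega> \<partial>R)"
      by auto
    have "AE \<omega> in R. H \<omega> + G \<omega> = (\<integral>\<^sup>+\<eta>. v \<eta> + u \<eta> \<partial>K \<omega>)"
      using G(1) H(1) AE_space by eventually_elim (simp add: nn_integral_add meas add)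
    moreover have "(\<integral>\<^sup>+\<omega>. H \<omega> + G \<omega> \<partial>R) = (\<integral>\<^sup>+\<omega>. v \<omega> + u \<omega> \<partial>R)"
      using G(2) H(2) add by (simp add: nn_integral_add)
    ultimately show ?case
      by (intro bexI[of _ "\<lambda>\<omega>. H \<omega> + G \<omega>"]) auto
  next
    case (seq U)
    then have "\<forall>i. \<exists>G. G \<in> borel_measurable R \<and> (AE \<omega> in R. G \<omega> = (\<integral>\<^sup>+\<eta>. U i \<eta> \<partial>K \<omega>)) \<and>
        (\<integral>\<^sup>+\<omega>. G \<omega> \<partial>R) = (\<integral>\<^sup>+\<omega>. U i \<omega> \<partial>R)"
      by blast
    then obtain G where [measurable]: "\<And>i. G i \<in> borel_measurable R"
      and G: "\<And>i. AE \<omega> in R. G i \<omega> = (\<integral>\<^sup>+\<eta>. U i \<eta> \<partial>K \<omega>)" "\<And>i. (\<integral>\<^sup>+\<omega>. G i \<omega> \<partial>R) = (\<integral>\<^sup>+\<omega>. U i \<omega> \<partial>R)"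
      by metis
    \<comment> \<open>The countably many null sets are merged. The versions \<open>G i\<close> are
      increasing only almost everywhere, so monotone convergence is applied in its almost-everywhere
      form.\<close>
    have all: "AE \<omega> in R. \<forall>i. G i \<omega> = (\<integral>\<^sup>+\<eta>. U i \<eta> \<partial>K \<omega>)"
      using G(1) by (simp add: AE_all_countable)
    have mono: "U i \<eta> \<le> U (Suc i) \<eta>" for i \<eta>
      using \<open>incseq U\<close> by (auto simp: incseq_Suc_iff le_fun_def)
    have "AE \<omega> in R. (SUP i. G i \<omega>) = (\<integral>\<^sup>+\<eta>. (SUP i. U i \<eta>) \<partial>K \<omega>)"
      using all AE_space
      by eventually_elim (simp add: nn_integral_monotone_convergence_SUP \<open>incseq U\<close> meas seq)
    moreover have "(\<integral>\<^sup>+\<omega>. (SUP i. G i \<omega>) \<partial>R) = (\<integral>\<^sup>+\<omega>. (SUP i. U i \<omega>) \<partial>R)"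
    proof -
      have "AE \<omega> in R. G i \<omega> \<le> G (Suc i) \<omega>" for i
        using all by eventually_elim (simp add: nn_integral_mono mono)
      then have "(\<integral>\<^sup>+\<omega>. (SUP i. G i \<omega>) \<partial>R) = (SUP i. \<integral>\<^sup>+\<omega>. G i \<omega> \<partial>R)"
        by (intro nn_integral_monotone_convergence_SUP_AE) auto
      also have "\<dots> = (\<integral>\<^sup>+\<omega>. (SUP i. U i \<omega>) \<partial>R)"
        by (simp add: G(2) nn_integral_monotone_convergence_SUP \<open>incseq U\<close> seq)
      finally show ?thesis .
    qed
    moreover have "Sup (range U) = (\<lambda>\<eta>. SUP i. U i \<eta>)"
      by (rule ext) (simp add: image_comp)
    ultimately show ?case
      by (intro bexI[of _ "\<lambda>\<omega>. SUP i. G i \<omega>"]) auto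
  qed
qed

text \<open>(D1) prescribes the masses of the sets \<open>B \<times> {j}\<close>, and these
  determine a measure on the state space.\<close>

lemma law_from_D1:
  fixes PP :: "real \<Rightarrow> real ^ 'd::finite \<Rightarrow> nat \<Rightarrow> (real \<Rightarrow> (real ^ 'd) \<times> nat) measure"
  assumes T: "0 < horizon S" and D1: "assumption_D1 S PP p"
    and i: "i \<in> regime_set S" and ts: "0 \<le> t" "t < s" "s \<le> horizon S"
    and sets: "sets (PP t x i) = sets (path_space S)"
  shows "distr (PP t x i) (state S) (\<lambda>\<omega>. \<omega> s) = density (state S) (transition p t s (x, i))"
proof (rule measure_state_eqI)
  fix B :: "(real ^ 'd) set" and j assume B: "B \<in> sets borel" and j: "j \<in> regime_set S"
  have p: "density_kernel S p" using D1 by (simp add: assumption_D1_def)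
  have s: "s \<in> {0..horizon S}" using ts by auto
  have ev: "(\<lambda>\<omega>. \<omega> s) \<in> measurable (PP t x i) (state S)"
    using measurable_evaluation[OF s T] by (simp add: measurable_cong_sets[OF sets refl])
  have Bj: "B \<times> {j} \<in> sets (state S)" by (rule Times_regime_in_sets_state[OF B j])
  have xi: "(\<lambda>w. (x, i)) \<in> measurable (state S) (state S)"
    using i by (auto simp: space_state)
  have tr: "transition p t s (x, i) \<in> borel_measurable (state S)"
    using measurable_transition[OF p ts xi measurable_ident] by simp
  have "emeasure (distr (PP t x i) (state S) (\<lambda>\<omega>. \<omega> s)) (B \<times> {j})
      = emeasure (PP t x i) {\<omega> \<in> paths S. fst (\<omega> s) \<in> B \<and> snd (\<omega> s) = j}"
    unfolding emeasure_distr[OF ev Bj] sets_eq_imp_space_eq[OF sets] space_path_space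
    by (rule arg_cong[where f = "emeasure _"]) (auto simp: mem_Times_iff)
  also have "\<dots> = (\<integral>\<^sup>+y\<in>B. ennreal (p i j t x s y) \<partial>lborel)"
    using D1 i j B ts unfolding assumption_D1_def by blast
  \<comment> \<open>The single integral is padded with zeros for the other regimes to match the
    regime-wise form of an integral over \<open>state S\<close>.\<close>
  also have "\<dots> = (\<Sum>k\<in>regime_set S. if k = j then \<integral>\<^sup>+y\<in>B. ennreal (p i j t x s y) \<partial>lborel else 0)"
    using j by simp
  also have "\<dots> = (\<Sum>k\<in>regime_set S. \<integral>\<^sup>+y. transition p t s (x, i) (y, k) * indicator (B \<times> {j}) (y, k) \<partial>lborel)"
    by (rule sum.cong) (auto simp: transition_def indicator_times intro!: nn_integral_cong)
  also have "\<dots> = (\<integral>\<^sup>+w. transition p t s (x, i) w * indicator (B \<times> {j}) w \<partial>state S)"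
    by (rule nn_integral_state[symmetric]) (use tr Bj in auto)
  also have "\<dots> = emeasure (density (state S) (transition p t s (x, i))) (B \<times> {j})"
    by (rule emeasure_density[symmetric, OF tr Bj])
  finally show "emeasure (distr (PP t x i) (state S) (\<lambda>\<omega>. \<omega> s)) (B \<times> {j}) =
      emeasure (density (state S) (transition p t s (x, i))) (B \<times> {j})" .
qed auto

text \<open>The strong Markov property at the constant time \<open>t\<close> replaces the event at
  time \<open>s\<close> by its probability under the family started from the state at
  \<open>t\<close>, and (D1) evaluates that probability.\<close>

lemma markov_family_indicator:
  fixes S :: "('d::finite, 'l::finite) sde"
  assumes T: "0 < horizon S" and G1: "assumption_G1 TYPE('w) S PP" and D1: "assumption_D1 S PP p"
    and i: "i \<in> regime_set S" and ts: "0 \<le> t" "t < s" "s \<le> horizon S"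
    and U: "U \<in> borel_measurable (natural_filtration S t)" and A: "A \<in> sets (state S)"
  shows "(\<integral>\<^sup>+\<omega>. U \<omega> * indicator A (\<omega> s) \<partial>PP 0 x i) =
    (\<integral>\<^sup>+\<omega>. U \<omega> * propagate S p t s (indicator A) (\<omega> t) \<partial>PP 0 x i)"
proof -
  have P: "sets (PP r y k) = sets (path_space S)" "prob_space (PP r y k)"
    if "r \<in> {0..horizon S}" "k \<in> regime_set S" for r y k
    using G1 that unfolding assumption_G1_def weak_solution_def path_measure_def
    by (auto simp: space_prob_algebra)
  let ?P = "PP 0 x i"
  have P0: "sets ?P = sets (path_space S)" "prob_space ?P"
    using P[of 0 i x] T i by auto
  have space: "space ?P = paths S"
    using sets_eq_imp_space_eq[OF P0(1)] by (simp add: space_path_space)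
  have s: "s \<in> {0..horizon S}" and t: "t \<in> {0..horizon S}" using ts by auto
  let ?F = "filtration.pre_sigma (paths S) (natural_filtration S) (\<lambda>_. t)"
  have setsF: "sets ?F = sets (natural_filtration S t)"
    by (rule sets_pre_sigma_const[OF filtration_natural_filtration])
  have spaceF: "space ?F = paths S"
    by (rule filtration.space_pre_sigma[OF filtration_natural_filtration])
  interpret prob_space ?P by fact
  interpret finite_measure_subalgebra ?P ?F
  proof
    show "subalgebra ?P ?F"
      using subalgebra_natural_filtration[OF T, of t]
      by (simp add: subalgebra_def setsF spaceF space P0)
  qed
  let ?A = "{\<eta> \<in> paths S. \<eta> s \<in> A}"
  have sA: "?A = (\<lambda>\<eta>. \<eta> s) -` A \<inter> space (path_space S)"
    by (auto simp: space_path_space)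
  have A': "?A \<in> sets (path_space S)"
    unfolding sA by (rule measurable_sets[OF measurable_evaluation[OF s T] A])
  \<comment> \<open>Freezing before \<open>t\<close> does not change the value at \<open>s\<close>,
    because \<open>s\<close> is later than \<open>t\<close>.\<close>
  have fr: "{\<eta> \<in> paths S. freeze (horizon S) t \<eta> \<in> ?A} = ?A"
    using freeze_in_paths[OF _ t] s ts by (auto simp: freeze_def max_def)
  have law: "emeasure (PP t (fst (\<omega> t)) (snd (\<omega> t))) ?A = propagate S p t s (indicator A) (\<omega> t)"
    if "\<omega> \<in> paths S" for \<omega>
  proof -
    have k: "snd (\<omega> t) \<in> regime_set S"
      using path_in_state[OF that t] by (auto simp: mem_Times_iff)
    let ?Q = "PP t (fst (\<omega> t)) (snd (\<omega> t))"
    have Q: "sets ?Q = sets (path_space S)" by (rule P(1)[OF t k])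
    have ev: "(\<lambda>\<omega>. \<omega> s) \<in> measurable ?Q (state S)"
      using measurable_evaluation[OF s T] by (simp add: measurable_cong_sets[OF Q refl])
    have z: "(\<lambda>w. \<omega> t) \<in> measurable (state S) (state S)"
      using path_in_state[OF that t] by (auto simp: space_state)
    have p: "density_kernel S p" using D1 by (simp add: assumption_D1_def)
    have tr: "transition p t s (\<omega> t) \<in> borel_measurable (state S)"
      using measurable_transition[OF p ts z measurable_ident] by simp
    have "emeasure ?Q ?A = emeasure (distr ?Q (state S) (\<lambda>\<omega>. \<omega> s)) A"
      unfolding emeasure_distr[OF ev A] sets_eq_imp_space_eq[OF Q] sA ..
    also have "\<dots> = emeasure (density (state S) (transition p t s (\<omega> t))) A"
      using law_from_D1[OF T D1 k ts Q] by simp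
    also have "\<dots> = propagate S p t s (indicator A) (\<omega> t)"
      by (simp add: emeasure_density[OF tr A] propagate_def mult.commute)
    finally show ?thesis .
  qed
  have "AE \<omega> in ?P. nn_cond_exp ?P ?F (indicator {\<eta> \<in> paths S. freeze (horizon S) t \<eta> \<in> ?A}) \<omega> =
      emeasure (PP t (fst (\<omega> t)) (snd (\<omega> t))) {\<eta> \<in> paths S. freeze (horizon S) t \<eta> \<in> ?A}"
  proof -
    have z: "0 \<in> {0..horizon S}" using T by simp
    have \<tau>: "stopping_time (natural_filtration S) (\<lambda>_. t) \<and> (\<forall>\<omega>\<in>paths S. t \<in> {0..horizon S})"
      using t by (simp add: stopping_time_const)
    have "strong_markov_family S PP" using G1 by (simp add: assumption_G1_def)
    note * = this[unfolded strong_markov_family_def, THEN bspec, OF z, THEN spec, THEN bspec, OF i,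
        THEN spec, of "\<lambda>_. t", THEN mp, OF \<tau>, THEN bspec, OF A']
    show ?thesis by (rule *)
  qed
  then have AE: "AE \<omega> in ?P. nn_cond_exp ?P ?F (indicator ?A) \<omega> = propagate S p t s (indicator A) (\<omega> t)"
    unfolding fr using AE_space by eventually_elim (simp add: space law)
  have U': "U \<in> borel_measurable ?F"
    using U by (simp add: measurable_cong_sets[OF setsF refl])
  have "(\<integral>\<^sup>+\<omega>. U \<omega> * indicator A (\<omega> s) \<partial>?P) = (\<integral>\<^sup>+\<omega>. U \<omega> * indicator ?A \<omega> \<partial>?P)"
    by (rule nn_integral_cong) (auto simp: space indicator_def)
  also have "\<dots> = (\<integral>\<^sup>+\<omega>. U \<omega> * nn_cond_exp ?P ?F (indicator ?A) \<omega> \<partial>?P)"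
    by (rule nn_cond_exp_intg[symmetric]) (use U' A' P0 in auto)
  also have "\<dots> = (\<integral>\<^sup>+\<omega>. U \<omega> * propagate S p t s (indicator A) (\<omega> t) \<partial>?P)"
    by (rule nn_integral_cong_AE) (use AE in eventually_elim, simp)
  finally show ?thesis .
qed

section \<open>Processes with a transition density\<close>

text \<open>The Markov property with density \<open>p\<close>, integrated against the past. In this
  form it mentions neither conditional expectations nor the family, and it is inherited by mixtures
  over the starting point.\<close>

locale markov_density =
  fixes S :: "('d::finite, 'l::finite) sde" and p :: "'d kernel"
    and R :: "(real \<Rightarrow> (real ^ 'd) \<times> nat) measure"
  assumes horizon_pos: "0 < horizon S"
    and kernel: "density_kernel S p"
    and sets_R: "sets R = sets (path_space S)"
    and prob_R: "prob_space R"
    and markov_indicator: "\<And>t s U A. 0 \<le> t \<Longrightarrow> t < s \<Longrightarrow> s \<le> horizon S \<Longrightarrow>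
      U \<in> borel_measurable (natural_filtration S t) \<Longrightarrow> A \<in> sets (state S) \<Longrightarrow>
      (\<integral>\<^sup>+\<omega>. U \<omega> * indicator A (\<omega> s) \<partial>R) =
      (\<integral>\<^sup>+\<omega>. U \<omega> * propagate S p t s (indicator A) (\<omega> t) \<partial>R)"
begin

sublocale prob_space R by (rule prob_R)

lemma space_R: "space R = paths S"
  using sets_eq_imp_space_eq[OF sets_R] by (simp add: space_path_space)

lemma measurable_evaluation_R:
  assumes "0 \<le> t" "t \<le> horizon S"
  shows "(\<lambda>\<omega>. \<omega> t) \<in> measurable R (state S)"
  using measurable_evaluation[of t S] assms horizon_pos
  by (simp add: measurable_cong_sets[OF sets_R refl])

lemma measurable_natural_filtration_R:
  assumes "U \<in> borel_measurable (natural_filtration S t)"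
  shows "U \<in> borel_measurable R"
  using measurable_from_subalg[OF subalgebra_natural_filtration[OF horizon_pos] assms]
  by (simp add: measurable_cong_sets[OF sets_R refl])

text \<open>Fubini turns the inner expectation into a function of \<open>w\<close>: it is the
  density of the state at \<open>s\<close> when the paths are weighted by \<open>U\<close>.\<close>

lemma nn_integral_propagate:
  assumes ts: "0 \<le> t" "t < s" "s \<le> horizon S"
    and [measurable]: "U \<in> borel_measurable R" "h \<in> borel_measurable (state S)"
  shows "(\<integral>\<^sup>+\<omega>. U \<omega> * propagate S p t s h (\<omega> t) \<partial>R) =
    (\<integral>\<^sup>+w. h w * (\<integral>\<^sup>+\<omega>. U \<omega> * transition p t s (\<omega> t) w \<partial>R) \<partial>state S)"
proof -
  interpret state: sigma_finite_measure "state S" by (rule sigma_finite_state)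
  interpret pair_sigma_finite R "state S" ..
  note [measurable] = measurable_transition[OF kernel ts]
  have [measurable]: "(\<lambda>\<omega>. \<omega> t) \<in> measurable R (state S)"
    by (rule measurable_evaluation_R) (use ts in auto)
  have "(\<integral>\<^sup>+\<omega>. U \<omega> * propagate S p t s h (\<omega> t) \<partial>R) =
      (\<integral>\<^sup>+\<omega>. (\<integral>\<^sup>+w. h w * (U \<omega> * transition p t s (\<omega> t) w) \<partial>state S) \<partial>R)"
  proof (rule nn_integral_cong)
    fix \<omega> assume \<omega> [measurable]: "\<omega> \<in> space R"
    have [measurable]: "(\<lambda>w. \<omega> t) \<in> measurable (state S) (state S)"
      using measurable_space[OF measurable_evaluation_R \<omega>] ts by auto
    have "U \<omega> * propagate S p t s h (\<omega> t) = (\<integral>\<^sup>+w. U \<omega> * (h w * transition p t s (\<omega> t) w) \<partial>state S)"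
      unfolding propagate_def by (rule nn_integral_cmult[symmetric]) measurable
    then show "U \<omega> * propagate S p t s h (\<omega> t) =
        (\<integral>\<^sup>+w. h w * (U \<omega> * transition p t s (\<omega> t) w) \<partial>state S)"
      by (simp add: ac_simps)
  qed
  also have "\<dots> = (\<integral>\<^sup>+w. (\<integral>\<^sup>+\<omega>. h w * (U \<omega> * transition p t s (\<omega> t) w) \<partial>R) \<partial>state S)"
    by (rule Fubini'[symmetric]) measurable
  also have "\<dots> = (\<integral>\<^sup>+w. h w * (\<integral>\<^sup>+\<omega>. U \<omega> * transition p t s (\<omega> t) w \<partial>R) \<partial>state S)"
  proof (rule nn_integral_cong)
    fix w assume "w \<in> space (state S)"
    then have [measurable]: "(\<lambda>\<omega>. w) \<in> measurable R (state S)" by simp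
    show "(\<integral>\<^sup>+\<omega>. h w * (U \<omega> * transition p t s (\<omega> t) w) \<partial>R) =
        h w * (\<integral>\<^sup>+\<omega>. U \<omega> * transition p t s (\<omega> t) w \<partial>R)"
      by (rule nn_integral_cmult) measurable
  qed
  finally show ?thesis .
qed

text \<open>Both sides integrate \<open>h\<close> against the same measure, the law of the state at
  \<open>s\<close> under the weight \<open>U\<close>. The indicator case identifies its density once
  and for all, so no induction on \<open>h\<close> is needed.\<close>

lemma markov_nn_integral:
  assumes ts: "0 \<le> t" "t < s" "s \<le> horizon S"
    and U: "U \<in> borel_measurable (natural_filtration S t)" and h: "h \<in> borel_measurable (state S)"
  shows "(\<integral>\<^sup>+\<omega>. U \<omega> * h (\<omega> s) \<partial>R) = (\<integral>\<^sup>+\<omega>. U \<omega> * propagate S p t s h (\<omega> t) \<partial>R)"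
proof -
  interpret state: sigma_finite_measure "state S" by (rule sigma_finite_state)
  note [measurable] = measurable_transition[OF kernel ts] measurable_natural_filtration_R[OF U] h
  have [measurable]: "(\<lambda>\<omega>. \<omega> t) \<in> measurable R (state S)" "(\<lambda>\<omega>. \<omega> s) \<in> measurable R (state S)"
    by (auto intro!: measurable_evaluation_R) (use ts in auto)
  let ?v = "\<lambda>w. \<integral>\<^sup>+\<omega>. U \<omega> * transition p t s (\<omega> t) w \<partial>R"
  have eq: "distr (density R U) (state S) (\<lambda>\<omega>. \<omega> s) = density (state S) ?v"
  proof (rule measure_eqI)
    fix A assume "A \<in> sets (distr (density R U) (state S) (\<lambda>\<omega>. \<omega> s))"
    then have A [measurable]: "A \<in> sets (state S)" by simp
    have "emeasure (distr (density R U) (state S) (\<lambda>\<omega>. \<omega> s)) A =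
        (\<integral>\<^sup>+\<omega>. indicator A (\<omega> s) \<partial>density R U)"
      by (subst nn_integral_indicator[symmetric], simp, subst nn_integral_distr, auto)
    also have "\<dots> = (\<integral>\<^sup>+\<omega>. U \<omega> * indicator A (\<omega> s) \<partial>R)"
      by (rule nn_integral_density) measurable
    also have "\<dots> = (\<integral>\<^sup>+w. indicator A w * ?v w \<partial>state S)"
      unfolding markov_indicator[OF ts U A] by (rule nn_integral_propagate[OF ts]) measurable
    also have "\<dots> = emeasure (density (state S) ?v) A"
      by (subst emeasure_density) (auto simp: mult.commute)
    finally show "emeasure (distr (density R U) (state S) (\<lambda>\<omega>. \<omega> s)) A = emeasure (density (state S) ?v) A" .
  qed simp
  have "(\<integral>\<^sup>+\<omega>. U \<omega> * h (\<omega> s) \<partial>R) = (\<integral>\<^sup>+w. h w \<partial>distr (density R U) (state S) (\<lambda>\<omega>. \<omega> s))"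
    by (simp add: nn_integral_distr nn_integral_density)
  also have "\<dots> = (\<integral>\<^sup>+w. h w * ?v w \<partial>state S)"
    unfolding eq by (subst nn_integral_density) (auto simp: mult.commute)
  also have "\<dots> = (\<integral>\<^sup>+\<omega>. U \<omega> * propagate S p t s h (\<omega> t) \<partial>R)"
    by (rule nn_integral_propagate[symmetric, OF ts]) measurable
  finally show ?thesis .
qed

end

text \<open>The extended counterpart of \<open>potential\<close>, defined without any integrability
  of \<open>G\<close>.\<close>

definition nn_potential :: "('d::finite, 'l::finite) sde \<Rightarrow> 'd kernel \<Rightarrow> ((real ^ 'd) \<times> nat \<Rightarrow> ennreal) \<Rightarrow>
    real \<Rightarrow> (real ^ 'd) \<times> nat \<Rightarrow> ennreal" where
  "nn_potential S p G t = (if t < horizon S then propagate S p t (horizon S) G else G)"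

context markov_density
begin

lemma measurable_nn_potential:
  assumes "0 \<le> t" "G \<in> borel_measurable (state S)"
  shows "nn_potential S p G t \<in> borel_measurable (state S)"
  using assms measurable_propagate[OF kernel, of t "horizon S" G] by (simp add: nn_potential_def)

lemma nn_potential_markov:
  assumes "0 \<le> t" "t \<le> horizon S" "U \<in> borel_measurable (natural_filtration S t)"
    and "G \<in> borel_measurable (state S)"
  shows "(\<integral>\<^sup>+\<omega>. U \<omega> * G (\<omega> (horizon S)) \<partial>R) = (\<integral>\<^sup>+\<omega>. U \<omega> * nn_potential S p G t (\<omega> t) \<partial>R)"
  using assms markov_nn_integral[of t "horizon S" U G] by (auto simp: nn_potential_def)

text \<open>Chapman--Kolmogorov for \<open>p\<close> is only available almost everywhere; the zero set of the
  potential is all that is needed.\<close>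

lemma nn_potential_zero:
  assumes ts: "0 \<le> t" "t < s" "s \<le> horizon S" and G: "G \<in> borel_measurable (state S)"
  shows "AE \<omega> in R. nn_potential S p G t (\<omega> t) = 0 \<longrightarrow> propagate S p t s (nn_potential S p G s) (\<omega> t) = 0"
proof -
  let ?Z = "{z \<in> space (state S). nn_potential S p G t z = 0}"
  have [measurable]: "nn_potential S p G t \<in> borel_measurable (state S)"
      "nn_potential S p G s \<in> borel_measurable (state S)"
    using measurable_nn_potential G ts by auto
  have [measurable]: "propagate S p t s (nn_potential S p G s) \<in> borel_measurable (state S)"
    by (rule measurable_propagate[OF kernel ts]) measurable
  have et [measurable]: "(\<lambda>\<omega>. \<omega> t) \<in> measurable R (state S)"
    by (rule measurable_evaluation_R) (use ts in auto)
  have [measurable]: "?Z \<in> sets (state S)" by measurable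
  let ?U = "\<lambda>\<omega>. indicator ?Z (\<omega> t) :: ennreal"
  have Ut: "?U \<in> borel_measurable (natural_filtration S t)"
    by (rule measurable_compose[OF measurable_evaluation_natural_filtration]) (use ts in auto)
  have Us: "?U \<in> borel_measurable (natural_filtration S s)"
    by (rule measurable_compose[OF measurable_evaluation_natural_filtration]) (use ts in auto)
  \<comment> \<open>The weight is the indicator of the zero set of the potential at
    \<open>t\<close>. Going from \<open>t\<close> up to \<open>s\<close>, on to the horizon and back
    to \<open>t\<close> leaves the integral of the potential at \<open>t\<close> over its own zero
    set.\<close>
  have "(\<integral>\<^sup>+\<omega>. ?U \<omega> * propagate S p t s (nn_potential S p G s) (\<omega> t) \<partial>R) =
      (\<integral>\<^sup>+\<omega>. ?U \<omega> * nn_potential S p G s (\<omega> s) \<partial>R)"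
    by (rule markov_nn_integral[symmetric, OF ts Ut]) measurable
  also have "\<dots> = (\<integral>\<^sup>+\<omega>. ?U \<omega> * G (\<omega> (horizon S)) \<partial>R)"
    by (rule nn_potential_markov[symmetric, OF _ _ Us G]) (use ts in auto)
  also have "\<dots> = (\<integral>\<^sup>+\<omega>. ?U \<omega> * nn_potential S p G t (\<omega> t) \<partial>R)"
    by (rule nn_potential_markov[OF _ _ Ut G]) (use ts in auto)
  also have "\<dots> = (\<integral>\<^sup>+\<omega>. 0 \<partial>R)"
    by (rule nn_integral_cong) (auto simp: indicator_def)
  finally have "(\<integral>\<^sup>+\<omega>. ?U \<omega> * propagate S p t s (nn_potential S p G s) (\<omega> t) \<partial>R) = 0"
    by simp
  then have "AE \<omega> in R. ?U \<omega> * propagate S p t s (nn_potential S p G s) (\<omega> t) = 0"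
    by (subst nn_integral_0_iff_AE[symmetric]) auto
  then show ?thesis
    using AE_space by eventually_elim (auto simp: indicator_def dest: measurable_space[OF et] split: if_splits)
qed

end

section \<open>Doob's transform\<close>

context markov_density
begin

text \<open>Nothing is required of \<open>Q\<close> where the potential at time \<open>t\<close> vanishes: there the propagated
  potential vanishes almost surely as well.\<close>

lemma nn_cond_exp_transform:
  assumes ts: "0 \<le> t" "t < s" "s \<le> horizon S"
    and F: "F \<in> borel_measurable (state S)" and G: "G \<in> borel_measurable (state S)"
    and fin: "finite_measure (density R (\<lambda>\<omega>. F (\<omega> 0) * G (\<omega> (horizon S))))"
    and A: "A \<in> sets (state S)" and Q: "Q \<in> borel_measurable (state S)"
    and Q_eq: "\<And>z. z \<in> space (state S) \<Longrightarrow> nn_potential S p G t z \<noteq> 0 \<Longrightarrow>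
      Q z * nn_potential S p G t z = propagate S p t s (\<lambda>w. indicator A w * nn_potential S p G s w) z"
  shows "AE \<omega> in density R (\<lambda>\<omega>. F (\<omega> 0) * G (\<omega> (horizon S))).
    nn_cond_exp (density R (\<lambda>\<omega>. F (\<omega> 0) * G (\<omega> (horizon S)))) (sigma_at S t)
      (indicator {\<eta> \<in> paths S. \<eta> s \<in> A}) \<omega> = Q (\<omega> t)"
proof -
  let ?D = "\<lambda>\<omega>. F (\<omega> 0) * G (\<omega> (horizon S))"
  let ?P = "density R ?D" and ?E = "{\<eta> \<in> paths S. \<eta> s \<in> A}"
  let ?\<phi> = "nn_potential S p G"
  note [measurable] = F G A Q
  have t: "t \<in> {0..horizon S}" using ts by auto
  have [measurable]: "(\<lambda>\<omega>. \<omega> 0) \<in> measurable R (state S)" "(\<lambda>\<omega>. \<omega> t) \<in> measurable R (state S)"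
      "(\<lambda>\<omega>. \<omega> s) \<in> measurable R (state S)" "(\<lambda>\<omega>. \<omega> (horizon S)) \<in> measurable R (state S)"
    using ts by (auto intro!: measurable_evaluation_R)
  have \<phi> [measurable]: "?\<phi> t \<in> borel_measurable (state S)" "?\<phi> s \<in> borel_measurable (state S)"
    using measurable_nn_potential G ts by auto
  have E: "?E \<in> sets R"
    unfolding space_R[symmetric] by measurable
  interpret P: finite_measure ?P by (rule fin)
  interpret P: finite_measure_subalgebra ?P "sigma_at S t"
    by standard (use subalgebra_sigma_at[OF t horizon_pos] in
      \<open>simp add: subalgebra_def sets_R space_R space_path_space\<close>)
  have dom: "AE \<omega> in R. propagate S p t s (\<lambda>w. indicator A w * ?\<phi> s w) (\<omega> t) = Q (\<omega> t) * ?\<phi> t (\<omega> t)"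
    using nn_potential_zero[OF ts G] AE_space
  proof eventually_elim
    case (elim \<omega>)
    then have z: "\<omega> t \<in> space (state S)"
      using path_in_state t by (simp add: space_R space_state)
    show ?case
    proof (cases "?\<phi> t (\<omega> t) = 0")
      case True
      \<comment> \<open>Dropping the indicator only increases the integral, and the larger one is
        already known to vanish here.\<close>
      have "propagate S p t s (\<lambda>w. indicator A w * ?\<phi> s w) (\<omega> t) \<le> propagate S p t s (?\<phi> s) (\<omega> t)"
        unfolding propagate_def by (intro nn_integral_mono) (auto simp: indicator_def)
      then show ?thesis using True elim by simp
    qed (use Q_eq[OF z] in simp)
  qed
  have "AE \<omega> in ?P. Q (\<omega> t) = nn_cond_exp ?P (sigma_at S t) (indicator ?E) \<omega>"
  proof (rule P.nn_cond_exp_charact)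
    fix C assume "C \<in> sets (sigma_at S t)"
    then obtain B where C: "C = (\<lambda>\<omega>. \<omega> t) -` B \<inter> paths S" and B [measurable]: "B \<in> sets (state S)"
      using sets_sigma_at[OF t] by auto
    have ind: "indicator C \<omega> = (indicator B (\<omega> t) :: ennreal)" "indicator ?E \<omega> = (indicator A (\<omega> s) :: ennreal)"
      if "\<omega> \<in> space R" for \<omega>
      using that by (auto simp: C space_R indicator_def)
    have C' [measurable]: "C \<in> sets R"
      unfolding C space_R[symmetric] by measurable
    let ?U = "\<lambda>\<omega>. F (\<omega> 0) * indicator B (\<omega> t)"
    have ev0: "(\<lambda>\<omega>. \<omega> 0) \<in> measurable (natural_filtration S r) (state S)" if "0 \<le> r" for r
      by (rule measurable_evaluation_natural_filtration) (use horizon_pos that in auto)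
    have evt: "(\<lambda>\<omega>. \<omega> t) \<in> measurable (natural_filtration S r) (state S)" if "t \<le> r" for r
      by (rule measurable_evaluation_natural_filtration) (use t that in auto)
    have evs: "(\<lambda>\<omega>. \<omega> s) \<in> measurable (natural_filtration S s) (state S)"
      by (rule measurable_evaluation_natural_filtration) (use ts in auto)
    have U: "?U \<in> borel_measurable (natural_filtration S t)"
        "(\<lambda>\<omega>. ?U \<omega> * indicator A (\<omega> s)) \<in> borel_measurable (natural_filtration S s)"
        "(\<lambda>\<omega>. ?U \<omega> * Q (\<omega> t)) \<in> borel_measurable (natural_filtration S t)"
      by (intro borel_measurable_times_ennreal measurable_compose[OF ev0 F] measurable_compose[OF evt]
          measurable_compose[OF evs] borel_measurable_indicator A B Q, use ts in auto)+
    have "(\<integral>\<^sup>+\<omega>\<in>C. indicator ?E \<omega> \<partial>?P) = (\<integral>\<^sup>+\<omega>. (?U \<omega> * indicator A (\<omega> s)) * G (\<omega> (horizon S)) \<partial>R)"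
      using E by (subst nn_integral_density) (auto simp: ind ac_simps intro!: nn_integral_cong)
    \<comment> \<open>The event at \<open>s\<close> belongs to the past of \<open>s\<close>, so the
      terminal factor is first averaged down to time \<open>s\<close> only; averaging it directly to
      \<open>t\<close> would require the event to be known at \<open>t\<close>.\<close>
    also have "\<dots> = (\<integral>\<^sup>+\<omega>. (?U \<omega> * indicator A (\<omega> s)) * ?\<phi> s (\<omega> s) \<partial>R)"
      by (rule nn_potential_markov) (use U ts G in auto)
    also have "\<dots> = (\<integral>\<^sup>+\<omega>. ?U \<omega> * (indicator A (\<omega> s) * ?\<phi> s (\<omega> s)) \<partial>R)"
      by (simp add: mult.assoc)
    also have "\<dots> = (\<integral>\<^sup>+\<omega>. ?U \<omega> * propagate S p t s (\<lambda>w. indicator A w * ?\<phi> s w) (\<omega> t) \<partial>R)"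
      by (rule markov_nn_integral[OF ts U(1)]) measurable
    also have "\<dots> = (\<integral>\<^sup>+\<omega>. (?U \<omega> * Q (\<omega> t)) * ?\<phi> t (\<omega> t) \<partial>R)"
      by (rule nn_integral_cong_AE) (use dom in eventually_elim, simp add: mult.assoc)
    \<comment> \<open>\<open>Q (\<omega> t)\<close> is known at \<open>t\<close>, so the potential
      can be turned back into the terminal factor, which restores the density of the transformed
      measure.\<close>
    also have "\<dots> = (\<integral>\<^sup>+\<omega>. (?U \<omega> * Q (\<omega> t)) * G (\<omega> (horizon S)) \<partial>R)"
      by (rule nn_potential_markov[symmetric]) (use U ts G in auto)
    also have "\<dots> = (\<integral>\<^sup>+\<omega>\<in>C. Q (\<omega> t) \<partial>?P)"
      by (subst nn_integral_density) (auto simp: ind ac_simps intro!: nn_integral_cong)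
    finally show "(\<integral>\<^sup>+\<omega>\<in>C. indicator ?E \<omega> \<partial>?P) = (\<integral>\<^sup>+\<omega>\<in>C. Q (\<omega> t) \<partial>?P)" .
  next
    show "indicator ?E \<in> borel_measurable ?P" using E by simp
    show "(\<lambda>\<omega>. Q (\<omega> t)) \<in> borel_measurable (sigma_at S t)"
      by (rule measurable_compose[OF measurable_sigma_at[OF t] Q])
  qed
  then show ?thesis by eventually_elim simp
qed

text \<open>The density factorizes at \<open>t\<close>: the future contributes the potential, and
  the past contributes the weight \<open>F\<close> at time 0 carried forward by the kernel. Strict
  positivity of \<open>t\<close> matters, since the kernel has a density only over a nonempty time
  interval.\<close>

lemma distributed_transform:
  assumes t: "0 < t" "t \<le> horizon S"
    and F: "F \<in> borel_measurable (state S)" and G: "G \<in> borel_measurable (state S)"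
    and v_eq: "\<And>w. w \<in> space (state S) \<Longrightarrow>
      v w = nn_potential S p G t w * (\<integral>\<^sup>+\<omega>. F (\<omega> 0) * transition p 0 t (\<omega> 0) w \<partial>R)"
  shows "distributed (density R (\<lambda>\<omega>. F (\<omega> 0) * G (\<omega> (horizon S)))) (state S) (\<lambda>\<omega>. \<omega> t) v"
  unfolding distributed_def
proof (intro conjI)
  let ?P = "density R (\<lambda>\<omega>. F (\<omega> 0) * G (\<omega> (horizon S)))"
  note [measurable] = F G measurable_transition[OF kernel _ t]
  have [measurable]: "(\<lambda>\<omega>. \<omega> 0) \<in> measurable R (state S)" "(\<lambda>\<omega>. \<omega> t) \<in> measurable R (state S)"
      "(\<lambda>\<omega>. \<omega> (horizon S)) \<in> measurable R (state S)"
    using t by (auto intro!: measurable_evaluation_R)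
  have \<phi> [measurable]: "nn_potential S p G t \<in> borel_measurable (state S)"
    using measurable_nn_potential G t by auto
  show v [measurable]: "v \<in> borel_measurable (state S)"
    by (subst measurable_cong[OF v_eq]) measurable
  show "(\<lambda>\<omega>. \<omega> t) \<in> measurable ?P (state S)" by simp
  show "distr ?P (state S) (\<lambda>\<omega>. \<omega> t) = density (state S) v"
  proof (rule measure_eqI)
    fix A assume "A \<in> sets (distr ?P (state S) (\<lambda>\<omega>. \<omega> t))"
    then have A [measurable]: "A \<in> sets (state S)" by simp
    have ev: "(\<lambda>\<omega>. \<omega> r) \<in> measurable (natural_filtration S u) (state S)" if "0 \<le> r" "r \<le> u" "u \<le> horizon S" for r u
      by (rule measurable_evaluation_natural_filtration) (use that in auto)
    have U: "(\<lambda>\<omega>. F (\<omega> 0) * indicator A (\<omega> t)) \<in> borel_measurable (natural_filtration S t)"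
      by (intro borel_measurable_times_ennreal measurable_compose[OF ev F] measurable_compose[OF ev]
          borel_measurable_indicator A) (use t in auto)
    have U0: "(\<lambda>\<omega>. F (\<omega> 0)) \<in> borel_measurable (natural_filtration S 0)"
      by (intro measurable_compose[OF ev F]) (use t in auto)
    have "emeasure (distr ?P (state S) (\<lambda>\<omega>. \<omega> t)) A = (\<integral>\<^sup>+\<omega>. indicator A (\<omega> t) \<partial>?P)"
      by (subst nn_integral_indicator[symmetric], simp, subst nn_integral_distr, auto)
    also have "\<dots> = (\<integral>\<^sup>+\<omega>. (F (\<omega> 0) * indicator A (\<omega> t)) * G (\<omega> (horizon S)) \<partial>R)"
      by (subst nn_integral_density) (auto simp: ac_simps)
    also have "\<dots> = (\<integral>\<^sup>+\<omega>. (F (\<omega> 0) * indicator A (\<omega> t)) * nn_potential S p G t (\<omega> t) \<partial>R)"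
      by (rule nn_potential_markov) (use U t G in auto)
    also have "\<dots> = (\<integral>\<^sup>+\<omega>. F (\<omega> 0) * (indicator A (\<omega> t) * nn_potential S p G t (\<omega> t)) \<partial>R)"
      by (simp add: mult.assoc)
    also have "\<dots> = (\<integral>\<^sup>+\<omega>. F (\<omega> 0) * propagate S p 0 t (\<lambda>w. indicator A w * nn_potential S p G t w) (\<omega> 0) \<partial>R)"
      by (rule markov_nn_integral[OF _ t U0]) auto
    also have "\<dots> = (\<integral>\<^sup>+w. indicator A w * nn_potential S p G t w *
        (\<integral>\<^sup>+\<omega>. F (\<omega> 0) * transition p 0 t (\<omega> 0) w \<partial>R) \<partial>state S)"
      by (rule nn_integral_propagate[OF _ t]) auto
    also have "\<dots> = (\<integral>\<^sup>+w. v w * indicator A w \<partial>state S)"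
      by (rule nn_integral_cong) (simp add: v_eq ac_simps)
    also have "\<dots> = emeasure (density (state S) v) A"
      by (rule emeasure_density[symmetric]) auto
    finally show "emeasure (distr ?P (state S) (\<lambda>\<omega>. \<omega> t)) A = emeasure (density (state S) v) A" .
  qed simp
qed

end

text \<open>\<open>R\<close> is a mixture of the laws \<open>PP 0 x i\<close>, and the Markov
  identity is linear in the law; disintegration given the initial state carries it over.\<close>

lemma markov_density_reference:
  fixes S :: "('d::finite, 'l::finite) sde"
  assumes T: "0 < horizon S" and G1: "assumption_G1 TYPE('w) S PP" and D1: "assumption_D1 S PP p"
    and G2: "assumption_G2 TYPE('w) S PP R0 R \<rho>0 \<rho>T"
  shows "markov_density S p R"
proof (rule markov_density.intro)
  show p: "density_kernel S p" using D1 by (simp add: assumption_D1_def)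
  have pm: "path_measure S R"
    using G2 by (simp add: assumption_G2_def weak_solution_def)
  then show setsR: "sets R = sets (path_space S)" and prob: "prob_space R"
    by (simp_all add: path_measure_def space_prob_algebra)
  fix t s :: real and U :: "(real \<Rightarrow> (real ^ 'd) \<times> nat) \<Rightarrow> ennreal" and A
  assume ts: "0 \<le> t" "t < s" "s \<le> horizon S"
    and U: "U \<in> borel_measurable (natural_filtration S t)" and A: "A \<in> sets (state S)"
  interpret prob_space R by fact
  have spR: "space R = paths S"
    using sets_eq_imp_space_eq[OF setsR] by (simp add: space_path_space)
  have zero: "0 \<in> {0..horizon S}" using T by simp
  let ?K = "\<lambda>\<omega>. PP 0 (fst (\<omega> 0)) (snd (\<omega> 0))"
  have reg: "snd (\<omega> 0) \<in> regime_set S" if "\<omega> \<in> space R" for \<omega>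
    using path_in_state[OF _ zero] that by (auto simp: spR mem_Times_iff)
  have K: "sets (?K \<omega>) = sets R" if "\<omega> \<in> space R" for \<omega>
    using G1 reg[OF that] zero setsR unfolding assumption_G1_def weak_solution_def path_measure_def
    by (auto simp: space_prob_algebra)
  have sub: "finite_measure_subalgebra R (sigma_at S 0)"
    by standard (use subalgebra_sigma_at[OF zero T] in
      \<open>simp add: subalgebra_def setsR spR space_path_space\<close>)
  have cond: "AE \<omega> in R. nn_cond_exp R (sigma_at S 0) (indicator A) \<omega> = emeasure (?K \<omega>) A" if "A \<in> sets R" for A
    using G2 that by (simp add: assumption_G2_def setsR)
  have disintegration: "\<exists>G \<in> borel_measurable R. (AE \<omega> in R. G \<omega> = (\<integral>\<^sup>+\<eta>. h \<eta> \<partial>?K \<omega>)) \<and>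
      (\<integral>\<^sup>+\<omega>. G \<omega> \<partial>R) = (\<integral>\<^sup>+\<omega>. h \<omega> \<partial>R)" if "h \<in> borel_measurable R" for h
    by (rule nn_integral_disintegration[OF sub _ _ that]) (fact K cond)+
  have mU: "U \<in> borel_measurable R"
    using measurable_from_subalg[OF subalgebra_natural_filtration[OF T] U]
    by (simp add: measurable_cong_sets[OF setsR refl])
  have ev: "(\<lambda>\<omega>. \<omega> r) \<in> measurable R (state S)" if "r \<in> {0..horizon S}" for r
    using measurable_evaluation[OF that T] by (simp add: measurable_cong_sets[OF setsR refl])
  let ?h = "\<lambda>\<omega>. U \<omega> * indicator A (\<omega> s)"
  let ?k = "\<lambda>\<omega>. U \<omega> * propagate S p t s (indicator A) (\<omega> t)"
  have h: "?h \<in> borel_measurable R"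
    by (intro borel_measurable_times_ennreal mU measurable_compose[OF ev] borel_measurable_indicator A)
      (use ts in auto)
  have k: "?k \<in> borel_measurable R"
    by (intro borel_measurable_times_ennreal mU measurable_compose[OF ev] measurable_propagate[OF p ts]
        borel_measurable_indicator A) (use ts in auto)
  obtain H where H: "AE \<omega> in R. H \<omega> = (\<integral>\<^sup>+\<eta>. ?h \<eta> \<partial>?K \<omega>)" "(\<integral>\<^sup>+\<omega>. H \<omega> \<partial>R) = (\<integral>\<^sup>+\<omega>. ?h \<omega> \<partial>R)"
    using disintegration[OF h] by blast
  obtain L where L: "AE \<omega> in R. L \<omega> = (\<integral>\<^sup>+\<eta>. ?k \<eta> \<partial>?K \<omega>)" "(\<integral>\<^sup>+\<omega>. L \<omega> \<partial>R) = (\<integral>\<^sup>+\<omega>. ?k \<omega> \<partial>R)"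
    using disintegration[OF k] by blast
  \<comment> \<open>For every starting point the two kernel integrals agree; only their measurable
    versions are compared almost everywhere.\<close>
  have "AE \<omega> in R. H \<omega> = L \<omega>"
    using H(1) L(1) AE_space
    by eventually_elim (simp add: markov_family_indicator[OF T G1 D1 reg ts U A])
  then show "(\<integral>\<^sup>+\<omega>. ?h \<omega> \<partial>R) = (\<integral>\<^sup>+\<omega>. ?k \<omega> \<partial>R)"
    unfolding H(2)[symmetric] L(2)[symmetric] by (rule nn_integral_cong_AE)
qed (fact T)

section \<open>Schroedinger potentials\<close>

text \<open>This links an expectation over the initial state to the regime-wise integrals in which
  \<open>copotential\<close> is written.\<close>

lemma nn_integral_slice:
  assumes \<mu>: "sets \<mu> = sets (state S)" and h: "h \<in> borel_measurable (state S)"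
  shows "(\<integral>\<^sup>+z. h z \<partial>\<mu>) = (\<Sum>i\<in>regime_set S. \<integral>\<^sup>+x. h (x, i) \<partial>slice \<mu> i)"
proof -
  have space: "space \<mu> = UNIV \<times> regime_set S"
    using sets_eq_imp_space_eq[OF \<mu>] by (simp add: space_state)
  have fst: "fst \<in> borel_measurable \<mu>"
    by (simp add: measurable_cong_sets[OF \<mu> refl] measurable_fst_state)
  have "(\<integral>\<^sup>+x. h (x, i) \<partial>slice \<mu> i) = (\<integral>\<^sup>+w. h (fst w, i) * indicator (UNIV \<times> {i}) w \<partial>\<mu>)"
      (is "?l = ?r") and "(\<lambda>w. h (fst w, i) * indicator (UNIV \<times> {i}) w) \<in> borel_measurable \<mu>"
    if i: "i \<in> regime_set S" for i
  proof -
    have hi: "(\<lambda>x. h (x, i)) \<in> borel_measurable borel"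
      by (rule measurable_compose[OF measurable_Pair_regime[OF i] h])
    have Bi: "UNIV \<times> {i} \<in> sets \<mu>"
      unfolding \<mu> by (rule Times_regime_in_sets_state) (use i in auto)
    have "?l = (\<integral>\<^sup>+w. h (fst w, i) \<partial>restrict_space \<mu> (UNIV \<times> {i}))"
      unfolding slice_def by (rule nn_integral_distr) (use fst hi in \<open>auto intro: measurable_restrict_space1\<close>)
    also have "\<dots> = ?r"
      by (rule nn_integral_restrict_space) (use Bi in auto)
    finally show "?l = ?r" .
    show "(\<lambda>w. h (fst w, i) * indicator (UNIV \<times> {i}) w) \<in> borel_measurable \<mu>"
      by (intro borel_measurable_times_ennreal measurable_compose[OF fst hi] borel_measurable_indicator Bi)
  qed
  note slice_eq = this
  have "(\<Sum>i\<in>regime_set S. \<integral>\<^sup>+x. h (x, i) \<partial>slice \<mu> i) =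
      (\<Sum>i\<in>regime_set S. \<integral>\<^sup>+w. h (fst w, i) * indicator (UNIV \<times> {i}) w \<partial>\<mu>)"
    by (rule sum.cong) (use slice_eq(1) in auto)
  also have "\<dots> = (\<integral>\<^sup>+w. (\<Sum>i\<in>regime_set S. h (fst w, i) * indicator (UNIV \<times> {i}) w) \<partial>\<mu>)"
    by (rule nn_integral_sum[symmetric]) (rule slice_eq(2))
  also have "\<dots> = (\<integral>\<^sup>+w. h w \<partial>\<mu>)"
  proof (rule nn_integral_cong)
    fix w assume w: "w \<in> space \<mu>"
    have "(\<Sum>i\<in>regime_set S. h (fst w, i) * indicator (UNIV \<times> {i}) w) =
        (\<Sum>i\<in>regime_set S. if i = snd w then h w else 0)"
      by (rule sum.cong) (auto simp: indicator_def mem_Times_iff)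
    then show "(\<Sum>i\<in>regime_set S. h (fst w, i) * indicator (UNIV \<times> {i}) w) = h w"
      using w by (simp add: space mem_Times_iff)
  qed
  finally show ?thesis by simp
qed

section \<open>Kernel sections and finiteness of the real-valued potentials\<close>

lemma measurable_kernel_fst:
  assumes "density_kernel S p" "i \<in> regime_set S" "j \<in> regime_set S" "0 \<le> t" "t < s" "s \<le> horizon S"
  shows "(\<lambda>x. p i j t x s y) \<in> borel_measurable borel"
proof -
  have "(\<lambda>(x, y). p i j t x s y) \<in> borel_measurable (borel \<Otimes>\<^sub>M borel)"
    using assms by (simp add: density_kernel_def)
  from measurable_compose[OF measurable_Pair2' this, of y] show ?thesis by simp
qed

lemma measurable_kernel_snd:
  assumes "density_kernel S p" "i \<in> regime_set S" "j \<in> regime_set S" "0 \<le> t" "t < s" "s \<le> horizon S"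
  shows "(\<lambda>y. p i j t x s y) \<in> borel_measurable borel"
proof -
  have "(\<lambda>(x, y). p i j t x s y) \<in> borel_measurable (borel \<Otimes>\<^sub>M borel)"
    using assms by (simp add: density_kernel_def)
  from measurable_compose[OF measurable_Pair1' this, of x] show ?thesis by simp
qed

lemma propagate_sum:
  assumes p: "density_kernel S p" and i: "i \<in> regime_set S" and ts: "0 \<le> t" "t < s" "s \<le> horizon S"
    and h: "h \<in> borel_measurable (state S)"
  shows "propagate S p t s h (x, i) =
    (\<Sum>j\<in>regime_set S. \<integral>\<^sup>+y. h (y, j) * ennreal (p i j t x s y) \<partial>lborel)"
proof -
  have xi: "(\<lambda>w. (x, i)) \<in> measurable (state S) (state S)"
    using i by (auto simp: space_state)
  have "propagate S p t s h (x, i) =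
      (\<Sum>j\<in>regime_set S. \<integral>\<^sup>+y. h (y, j) * transition p t s (x, i) (y, j) \<partial>lborel)"
    unfolding propagate_def
    by (rule nn_integral_state) (use h measurable_transition[OF p ts xi measurable_ident] in simp)
  then show ?thesis by (simp add: transition_def)
qed

lemma integrable_mult_bounded:
  fixes h k :: "'a \<Rightarrow> real"
  assumes h: "integrable M h" and k: "k \<in> borel_measurable M" "bounded (range k)"
  shows "integrable M (\<lambda>x. k x * h x)"
proof -
  obtain c where c: "\<And>x. norm (k x) \<le> c"
    using k(2) by (auto simp: bounded_iff)
  show ?thesis
  proof (rule Bochner_Integration.integrable_bound)
    show "integrable M (\<lambda>x. c * h x)" using h by simp
    show "(\<lambda>x. k x * h x) \<in> borel_measurable M"
      by (rule borel_measurable_times[OF k(1) borel_measurable_integrable[OF h]])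
    have "norm (k x * h x) \<le> norm (c * h x)" for x
    proof -
      have "\<bar>k x\<bar> \<le> \<bar>c\<bar>" using c[of x] by simp
      then show ?thesis by (simp add: abs_mult mult_right_mono)
    qed
    then show "AE x in M. norm (k x * h x) \<le> norm (c * h x)" by simp
  qed
qed

text \<open>The total mass of the section is the probability, under \<open>PP t x i\<close>, of
  being in regime \<open>j\<close> at time \<open>s\<close>, hence finite for every
  \<open>x\<close>.\<close>

lemma integrable_kernel:
  fixes S :: "('d::finite, 'l::finite) sde"
  assumes T: "0 < horizon S" and G1: "assumption_G1 TYPE('w) S PP" and D1: "assumption_D1 S PP p"
    and i: "i \<in> regime_set S" and j: "j \<in> regime_set S" and ts: "0 \<le> t" "t < s" "s \<le> horizon S"
  shows "integrable lborel (\<lambda>y. p i j t x s y)"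
proof (rule integrableI_nonneg)
  have p: "density_kernel S p" using D1 by (simp add: assumption_D1_def)
  show "(\<lambda>y. p i j t x s y) \<in> borel_measurable lborel"
    using measurable_kernel_snd[OF p i j ts] by simp
  show "AE y in lborel. 0 \<le> p i j t x s y"
    using p i j ts by (simp add: density_kernel_def)
  have "t \<in> {0..horizon S}" using ts by auto
  then have "weak_solution TYPE('w) S t (PP t x i)"
    using G1 i by (simp add: assumption_G1_def)
  then have "prob_space (PP t x i)"
    by (simp add: weak_solution_def path_measure_def space_prob_algebra)
  then interpret prob_space "PP t x i" .
  have "(UNIV :: (real ^ 'd) set) \<in> sets borel" by simp
  then have "emeasure (PP t x i) {\<omega> \<in> paths S. fst (\<omega> s) \<in> UNIV \<and> snd (\<omega> s) = j} =
      (\<integral>\<^sup>+y\<in>UNIV. ennreal (p i j t x s y) \<partial>lborel)"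
    using D1 i j ts unfolding assumption_D1_def by blast
  then show "(\<integral>\<^sup>+y. ennreal (p i j t x s y) \<partial>lborel) < \<infinity>"
    using emeasure_finite[of "{\<omega> \<in> paths S. fst (\<omega> s) \<in> UNIV \<and> snd (\<omega> s) = j}"] by (simp add: less_top[symmetric])
qed

text \<open>A bounded \<open>g\<close> times an integrable kernel section is integrable, so the
  Bochner integrals in \<open>potential\<close> are genuine and agree with the extended ones at
  every point.\<close>

lemma ennreal_potential:
  assumes T: "0 < horizon S" and G1: "assumption_G1 TYPE('w) S PP" and D1: "assumption_D1 S PP p"
    and g: "g \<in> borel_measurable (state S)" "\<And>z. z \<in> space (state S) \<Longrightarrow> 0 \<le> g z"
      "\<And>j. j \<in> regime_set S \<Longrightarrow> bounded (range (\<lambda>y. g (y, j)))"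
    and i: "i \<in> regime_set S" and t: "0 \<le> t"
  shows "ennreal (potential S g p t x i) = nn_potential S p (\<lambda>z. ennreal (g z)) t (x, i)"
    and "0 \<le> potential S g p t x i"
proof -
  have p: "density_kernel S p" using D1 by (simp add: assumption_D1_def)
  have g0: "0 \<le> g (y, j)" if "j \<in> regime_set S" for y j
    using g(2) that by (simp add: space_state)
  have p0: "0 \<le> p i j t x s y" if "j \<in> regime_set S" "t < s" "s \<le> horizon S" for j s y
    using p i t that by (simp add: density_kernel_def)
  have "ennreal (potential S g p t x i) = nn_potential S p (\<lambda>z. ennreal (g z)) t (x, i) \<and>
      0 \<le> potential S g p t x i"
  proof (cases "t < horizon S")
    case True
    have gp: "0 \<le> g (y, j) * p i j t x (horizon S) y" if "j \<in> regime_set S" for y j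
      using g0 p0 True that by simp
    have "(\<integral>\<^sup>+y. ennreal (g (y, j)) * ennreal (p i j t x (horizon S) y) \<partial>lborel) =
        ennreal (\<integral>y. g (y, j) * p i j t x (horizon S) y \<partial>lborel)" if j: "j \<in> regime_set S" for j
    proof -
      have "(\<lambda>y. g (y, j)) \<in> borel_measurable lborel"
        using measurable_compose[OF measurable_Pair_regime[OF j] g(1)] by simp
      then have "integrable lborel (\<lambda>y. g (y, j) * p i j t x (horizon S) y)"
        by (intro integrable_mult_bounded integrable_kernel[OF T G1 D1 i j t True] g(3) j) auto
      then show ?thesis
        using gp[OF j] g0[OF j]
        by (subst nn_integral_eq_integral[symmetric]) (auto simp: ennreal_mult')
    qed
    moreover have "(\<lambda>z. ennreal (g z)) \<in> borel_measurable (state S)" using g(1) by simp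
    ultimately have "propagate S p t (horizon S) (\<lambda>z. ennreal (g z)) (x, i) =
        (\<Sum>j\<in>regime_set S. ennreal (\<integral>y. g (y, j) * p i j t x (horizon S) y \<partial>lborel))"
      using propagate_sum[OF p i t True order_refl, of "\<lambda>z. ennreal (g z)" x] by simp
    then show ?thesis
      using True gp by (auto simp: potential_def nn_potential_def sum_ennreal intro!: sum_nonneg)
  next
    case False
    then show ?thesis using g0[OF i] by (simp add: potential_def nn_potential_def)
  qed
  then show "ennreal (potential S g p t x i) = nn_potential S p (\<lambda>z. ennreal (g z)) t (x, i)"
    and "0 \<le> potential S g p t x i" by auto
qed

text \<open>The roles of the two factors are exchanged: now \<open>f\<close> is integrable over each
  slice of \<open>R0\<close>, and the kernel supplies the bound.\<close>

lemma ennreal_copotential: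
  assumes D1: "assumption_D1 S PP p" and D2: "assumption_D2 S R0 f g"
    and f: "f \<in> borel_measurable (state S)" "\<And>z. z \<in> space (state S) \<Longrightarrow> 0 \<le> f z"
    and R0: "sets R0 = sets (state S)"
    and j: "j \<in> regime_set S" and s: "0 < s" "s \<le> horizon S"
  shows "ennreal (copotential S R0 f p s y j) = (\<integral>\<^sup>+z. ennreal (f z) * transition p 0 s z (y, j) \<partial>R0)"
proof -
  have p: "density_kernel S p" using D1 by (simp add: assumption_D1_def)
  have f0: "0 \<le> f (x, i)" if "i \<in> regime_set S" for x i
    using f(2) that by (simp add: space_state)
  have p0: "0 \<le> p i j 0 x s y" if "i \<in> regime_set S" for x i
    using p s j that by (simp add: density_kernel_def)
  \<comment> \<open>The joint bound in both positions gives the bound in the starting point for each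
    fixed \<open>y\<close>.\<close>
  have bnd: "bounded (range (\<lambda>x. p i j 0 x s y))" if "i \<in> regime_set S" for i
  proof -
    have "bounded (range (\<lambda>(x, y). p i j 0 x s y))"
      using D1 that j s by (simp add: assumption_D1_def)
    then show ?thesis by (rule bounded_subset) auto
  qed
  have slice: "(\<integral>\<^sup>+x. ennreal (f (x, i)) * ennreal (p i j 0 x s y) \<partial>slice R0 i) =
      ennreal (\<integral>x. f (x, i) * p i j 0 x s y \<partial>slice R0 i)" if i: "i \<in> regime_set S" for i
  proof -
    have fi: "(\<lambda>x. f (x, i)) \<in> borel_measurable (slice R0 i)"
      using measurable_compose[OF measurable_Pair_regime[OF i] f(1)] by (simp add: slice_def)
    have pi: "(\<lambda>x. p i j 0 x s y) \<in> borel_measurable (slice R0 i)"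
      using measurable_kernel_fst[OF p i j order_refl s] by (simp add: slice_def)
    have "integrable (slice R0 i) (\<lambda>x. f (x, i))"
      by (rule integrableI_nonneg[OF fi]) (use f0[OF i] D2 i in \<open>auto simp: assumption_D2_def\<close>)
    then have "integrable (slice R0 i) (\<lambda>x. f (x, i) * p i j 0 x s y)"
      using integrable_mult_bounded[OF _ pi bnd[OF i]] by (simp add: mult.commute)
    then show ?thesis
      using p0[OF i] f0[OF i]
      by (subst nn_integral_eq_integral[symmetric]) (auto simp: ennreal_mult')
  qed
  have yj: "(\<lambda>z. (y, j)) \<in> measurable (state S) (state S)"
    using j by (auto simp: space_state)
  have "(\<integral>\<^sup>+z. ennreal (f z) * transition p 0 s z (y, j) \<partial>R0) =
      (\<Sum>i\<in>regime_set S. \<integral>\<^sup>+x. ennreal (f (x, i)) * transition p 0 s (x, i) (y, j) \<partial>slice R0 i)"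
    by (rule nn_integral_slice[OF R0])
      (use f(1) measurable_transition[OF p order_refl s measurable_ident yj] in simp)
  also have "\<dots> = ennreal (copotential S R0 f p s y j)"
    using f0 p0 by (simp add: transition_def slice copotential_def sum_ennreal)
  finally show ?thesis by simp
qed

section \<open>Transition density and marginals of the bridge\<close>

theorem theorem3p1p2:
  fixes S :: "('d::finite, 'l::finite) sde"
    and PP :: "real \<Rightarrow> real ^ 'd \<Rightarrow> nat \<Rightarrow> (real \<Rightarrow> (real ^ 'd) \<times> nat) measure"
    and R Phat :: "(real \<Rightarrow> (real ^ 'd) \<times> nat) measure"
    and R0 \<rho>0 \<rho>T :: "((real ^ 'd) \<times> nat) measure"
    and f g :: "(real ^ 'd) \<times> nat \<Rightarrow> real"
    and p :: "'d kernel"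
  assumes "reference_data S"
    and "assumption_C S"
    and "assumption_G1 TYPE('w) S PP"
    and "assumption_G2 TYPE('w) S PP R0 R \<rho>0 \<rho>T"
    and "schroedinger_bridge S R \<rho>0 \<rho>T Phat"
    and "schroedinger_factors S R \<rho>0 \<rho>T Phat f g"
    and "assumption_D1 S PP p"
    and "assumption_D2 S R0 f g"
  shows "has_transition_density S Phat
      (\<lambda>i j t x s y.
        if potential S g p t x i > 0
        then potential S g p s y j / potential S g p t x i * p i j t x s y
        else 0) \<and>
    (\<forall>t\<in>{0<..horizon S}.
      distributed Phat (state S) (\<lambda>\<omega>. \<omega> t)
        (\<lambda>(x, i). ennreal (potential S g p t x i * copotential S R0 f p t x i)))"
proof -
  have T: "0 < horizon S" using assms(1) by (simp add: reference_data_def)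
  have p: "density_kernel S p" using assms(7) by (simp add: assumption_D1_def)
  interpret markov_density S p R
    by (rule markov_density_reference[OF T assms(3,7,4)])
  have f: "f \<in> borel_measurable (state S)" "\<And>z. z \<in> space (state S) \<Longrightarrow> 0 \<le> f z"
    and g: "g \<in> borel_measurable (state S)" "\<And>z. z \<in> space (state S) \<Longrightarrow> 0 \<le> g z"
    and Phat: "Phat = density R (\<lambda>\<omega>. ennreal (f (\<omega> 0) * g (\<omega> (horizon S))))"
    using assms(6) by (auto simp: schroedinger_factors_def)
  have g_bnd: "bounded (range (\<lambda>y. g (y, j)))" if "j \<in> regime_set S" for j
    using assms(8) that by (simp add: assumption_D2_def)
  define F where "F = (\<lambda>z. ennreal (f z))"
  define G where "G = (\<lambda>z. ennreal (g z))"
  have F: "F \<in> borel_measurable (state S)" and G: "G \<in> borel_measurable (state S)"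
    using f(1) g(1) by (simp_all add: F_def G_def)
  have ev: "(\<lambda>\<omega>. \<omega> r) \<in> measurable R (state S)" if "r \<in> {0..horizon S}" for r
    using measurable_evaluation_R that by simp
  have state_R: "\<omega> r \<in> space (state S)" if "\<omega> \<in> space R" "r \<in> {0..horizon S}" for \<omega> r
    using path_in_state that by (simp add: space_R space_state)
  \<comment> \<open>The factors are nonnegative on the state space, where all path values lie, so
    the product splits in \<open>ennreal\<close>.\<close>
  have Phat_FG: "Phat = density R (\<lambda>\<omega>. F (\<omega> 0) * G (\<omega> (horizon S)))"
    unfolding Phat F_def G_def
  proof (rule density_cong)
    have [measurable]: "(\<lambda>\<omega>. \<omega> 0) \<in> measurable R (state S)" "(\<lambda>\<omega>. \<omega> (horizon S)) \<in> measurable R (state S)"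
      using T by (auto intro!: ev)
    note [measurable] = f(1) g(1)
    show "(\<lambda>\<omega>. ennreal (f (\<omega> 0) * g (\<omega> (horizon S)))) \<in> borel_measurable R"
      "(\<lambda>\<omega>. ennreal (f (\<omega> 0)) * ennreal (g (\<omega> (horizon S)))) \<in> borel_measurable R"
      by measurable
    show "AE \<omega> in R. ennreal (f (\<omega> 0) * g (\<omega> (horizon S))) = ennreal (f (\<omega> 0)) * ennreal (g (\<omega> (horizon S)))"
      using T by (intro AE_I2 ennreal_mult f g state_R) auto
  qed
  \<comment> \<open>The bridge is admissible in its own minimization problem; this makes the
    transformed measure finite, as conditioning under it requires.\<close>
  have "prob_space Phat"
    using assms(5) by (auto simp: schroedinger_bridge_def is_arg_min_def path_measure_def space_prob_algebra)
  then have fin: "finite_measure (density R (\<lambda>\<omega>. F (\<omega> 0) * G (\<omega> (horizon S))))"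
    unfolding Phat_FG by (rule prob_space.finite_measure)

  let ?\<phi> = "potential S g p"
  have \<phi>_eq: "ennreal (?\<phi> t x i) = nn_potential S p G t (x, i)" and \<phi>_nonneg: "0 \<le> ?\<phi> t x i"
    if "i \<in> regime_set S" "0 \<le> t" for t x i
    unfolding G_def
    by (rule ennreal_potential[OF T assms(3,7) g(1) _ _ that]; fact g(2) g_bnd)+
  have \<phi>_meas: "(\<lambda>x. ?\<phi> t x i) \<in> borel_measurable borel" if t: "0 \<le> t" and i: "i \<in> regime_set S" for t i
  proof -
    \<comment> \<open>Measurability in \<open>x\<close> is inherited from the extended
      potential.\<close>
    have "?\<phi> t x i = enn2real (nn_potential S p G t (x, i))" for x
      using \<phi>_eq[OF i t] \<phi>_nonneg[OF i t] by (metis enn2real_ennreal)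
    then show ?thesis
      using measurable_compose[OF measurable_Pair_regime[OF i] measurable_nn_potential[OF t G]] by simp
  qed

  define q where "q = (\<lambda>i j t x s y.
    if ?\<phi> t x i > 0 then ?\<phi> s y j / ?\<phi> t x i * p i j t x s y else 0)"
  have q_kernel: "density_kernel S q"
    unfolding density_kernel_def
  proof (intro ballI allI impI conjI)
    fix i j t s assume i: "i \<in> regime_set S" and j: "j \<in> regime_set S"
      and ts: "0 \<le> t \<and> t < s \<and> s \<le> horizon S"
    have [measurable]: "(\<lambda>z. p i j t (fst z) s (snd z)) \<in> borel_measurable (borel \<Otimes>\<^sub>M borel)"
      using p i j ts by (simp add: density_kernel_def case_prod_unfold)
    have [measurable]: "(\<lambda>x. ?\<phi> t x i) \<in> borel_measurable borel" "(\<lambda>x. ?\<phi> s x j) \<in> borel_measurable borel"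
      using \<phi>_meas i j ts by auto
    show "(\<lambda>(x, y). q i j t x s y) \<in> borel_measurable (borel \<Otimes>\<^sub>M borel)"
      unfolding q_def case_prod_unfold by measurable
    show "0 \<le> q i j t x s y" for x y
      using \<phi>_nonneg[OF j, of s y] p i j ts by (auto simp: q_def density_kernel_def)
  qed

  have "AE \<omega> in Phat. nn_cond_exp Phat (sigma_at S t) (indicator {\<eta> \<in> paths S. fst (\<eta> s) \<in> B \<and> snd (\<eta> s) = j}) \<omega> =
      (\<integral>\<^sup>+y\<in>B. ennreal (q (snd (\<omega> t)) j t (fst (\<omega> t)) s y) \<partial>lborel)"
    if ts: "0 \<le> t" "t < s" "s \<le> horizon S" and j: "j \<in> regime_set S" and B: "B \<in> sets borel" for t s j B
  proof -
    let ?A = "B \<times> {j}"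
    let ?Q = "\<lambda>z. \<integral>\<^sup>+y\<in>B. ennreal (q (snd z) j t (fst z) s y) \<partial>lborel"
    have A: "?A \<in> sets (state S)" by (rule Times_regime_in_sets_state[OF B j])
    have q_section: "(\<lambda>x. \<integral>\<^sup>+y\<in>B. ennreal (q i j t x s y) \<partial>lborel) \<in> borel_measurable borel"
      if i: "i \<in> regime_set S" for i
    proof -
      have [measurable]: "(\<lambda>z. q i j t (fst z) s (snd z)) \<in> borel_measurable (borel \<Otimes>\<^sub>M borel)"
        using q_kernel i j ts by (simp add: density_kernel_def case_prod_unfold)
      note [measurable] = B
      show ?thesis
        by (rule lborel.borel_measurable_nn_integral) (simp add: case_prod_unfold, measurable)
    qed
    have Q: "?Q \<in> borel_measurable (state S)"
      by (rule measurable_compose_countable'[where I = "regime_set S" and g = snd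
          and f = "\<lambda>i z. \<integral>\<^sup>+y\<in>B. ennreal (q i j t (fst z) s y) \<partial>lborel"])
        (auto intro: measurable_compose[OF measurable_fst_state q_section] countable_finite)
    have \<phi>s: "nn_potential S p G s \<in> borel_measurable (state S)"
      using measurable_nn_potential[OF _ G] ts by simp
    have "?Q z * nn_potential S p G t z = propagate S p t s (\<lambda>w. indicator ?A w * nn_potential S p G s w) z"
      if z: "z \<in> space (state S)" and nz: "nn_potential S p G t z \<noteq> 0" for z
    proof -
      obtain x i where xi: "z = (x, i)" and i: "i \<in> regime_set S"
        using z by (auto simp: space_state)
      have \<phi>t: "nn_potential S p G t z = ennreal (?\<phi> t x i)"
        using \<phi>_eq[OF i ts(1)] xi by simp
      then have pos: "0 < ?\<phi> t x i"
        using nz by (metis ennreal_eq_0_iff not_le)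
      have s0: "0 \<le> s" using ts by simp
      \<comment> \<open>Multiplying by the potential at \<open>t\<close>, which is positive and
        finite here, cancels the denominator of \<open>q\<close>.\<close>
      have pt: "ennreal (q i j t x s y) * ennreal (?\<phi> t x i) =
          nn_potential S p G s (y, j) * ennreal (p i j t x s y)" for y
      proof -
        have "ennreal (q i j t x s y) * ennreal (?\<phi> t x i) = ennreal (q i j t x s y * ?\<phi> t x i)"
          using pos by (simp add: ennreal_mult'')
        also have "q i j t x s y * ?\<phi> t x i = ?\<phi> s y j * p i j t x s y"
          using pos by (simp add: q_def)
        also have "ennreal \<dots> = ennreal (?\<phi> s y j) * ennreal (p i j t x s y)"
          by (rule ennreal_mult'[OF \<phi>_nonneg[OF j s0]])
        finally show ?thesis using \<phi>_eq[OF j s0] by simp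
      qed
      have qm: "(\<lambda>y. ennreal (q i j t x s y)) \<in> borel_measurable borel"
        using measurable_kernel_snd[OF q_kernel i j ts, of x] by simp
      have "?Q z * nn_potential S p G t z =
          (\<integral>\<^sup>+y. ennreal (q i j t x s y) * indicator B y * ennreal (?\<phi> t x i) \<partial>lborel)"
        using \<phi>t qm B unfolding xi by (subst nn_integral_multc) auto
      also have "\<dots> = (\<integral>\<^sup>+y. indicator B y * nn_potential S p G s (y, j) * ennreal (p i j t x s y) \<partial>lborel)"
      proof (rule nn_integral_cong)
        fix y
        show "ennreal (q i j t x s y) * indicator B y * ennreal (?\<phi> t x i) =
            indicator B y * nn_potential S p G s (y, j) * ennreal (p i j t x s y)"
          using pt[of y] by (simp add: indicator_def)
      qed
      also have "\<dots> = (\<Sum>k\<in>regime_set S. if k = j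
          then \<integral>\<^sup>+y. indicator B y * nn_potential S p G s (y, j) * ennreal (p i j t x s y) \<partial>lborel else 0)"
        using j by simp
      also have "\<dots> = (\<Sum>k\<in>regime_set S. \<integral>\<^sup>+y. indicator ?A (y, k) * nn_potential S p G s (y, k) *
          ennreal (p i k t x s y) \<partial>lborel)"
        by (rule sum.cong) (auto simp: indicator_times)
      also have "\<dots> = propagate S p t s (\<lambda>w. indicator ?A w * nn_potential S p G s w) z"
        unfolding xi
        by (rule propagate_sum[symmetric, OF p i ts]) (use \<phi>s A in auto)
      finally show ?thesis .
    qed
    from nn_cond_exp_transform[OF ts F G fin A Q this, folded Phat_FG]
    show ?thesis by (simp add: mem_Times_iff)
  qed
  then have "has_transition_density S Phat q"
    using q_kernel by (simp add: has_transition_density_def)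

  moreover have "distributed Phat (state S) (\<lambda>\<omega>. \<omega> t)
      (\<lambda>(x, i). ennreal (?\<phi> t x i * copotential S R0 f p t x i))" if t: "t \<in> {0<..horizon S}" for t
    unfolding Phat_FG
  proof (rule distributed_transform[OF _ _ F G])
    show t': "0 < t" "t \<le> horizon S" using t by auto
    fix w assume "w \<in> space (state S)"
    then obtain y j where w: "w = (y, j)" and j: "j \<in> regime_set S"
      by (auto simp: space_state)
    have R0: "R0 = distr R (state S) (\<lambda>\<omega>. \<omega> 0)"
      using assms(4) by (simp add: assumption_G2_def marginal_def)
    have sets_R0: "sets R0 = sets (state S)"
      unfolding R0 by (rule sets_distr)
    have yj: "(\<lambda>z. (y, j)) \<in> measurable (state S) (state S)"
      using j by (auto simp: space_state)
    have "ennreal (copotential S R0 f p t y j) = (\<integral>\<^sup>+z. F z * transition p 0 t z (y, j) \<partial>R0)"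
      unfolding F_def by (rule ennreal_copotential[OF assms(7,8) f sets_R0 j t'])
    \<comment> \<open>\<open>R0\<close> is the law of the initial state under \<open>R\<close>, so
      the integral over it becomes the expectation that the marginal formula calls for.\<close>
    also have "\<dots> = (\<integral>\<^sup>+\<omega>. F (\<omega> 0) * transition p 0 t (\<omega> 0) (y, j) \<partial>R)"
      unfolding R0
      by (rule nn_integral_distr) (use ev[of 0] T F measurable_transition[OF p order_refl t' measurable_ident yj] in auto)
    finally show "(case w of (x, i) \<Rightarrow> ennreal (?\<phi> t x i * copotential S R0 f p t x i)) =
        nn_potential S p G t w * (\<integral>\<^sup>+\<omega>. F (\<omega> 0) * transition p 0 t (\<omega> 0) w \<partial>R)"
      using \<phi>_eq[OF j, of t y] \<phi>_nonneg[OF j, of t y] t' by (simp add: w ennreal_mult')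
  qed
  ultimately show ?thesis
    unfolding q_def by blast
qed

end
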